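(* Assume the standing setup (see context), that $\varphi\not\equiv0$, that $z\not\equiv\pm z_i\pmod\Lambda$ for all $i$, and that $z_i\not\equiv -z_j\pmod\Lambda$ for all $i\neq j$. Then $\varphi(s)$ is a polynomial in $\wp(s)$ of degree exactly $\ell+1$ whose roots are the $\ell+1$ distinct numbers $\wp(z_1),\ldots,\wp(z_\ell),\wp(z)$; in particular $\mu(\ell+1)\neq0$ and for every $r=0,1,\ldots,\ell+1$, \[ S_r\big(\wp(z_1),\ldots,\wp(z_\ell),\wp(z)\big)=(-1)^r\frac{\mu(\ell+1-r)}{\mu(\ell+1)}. \]
   Context: Let $\omega_1,\omega_2\in\mathbb{C}$ with $\mathrm{Im}(\omega_2/\omega_1)>0$, $\Lambda=2\omega_1\mathbb{Z}+2\omega_2\mathbb{Z}$, $\wp$ the Weierstrass elliptic function of $\Lambda$ with invariants $g_2,g_3$, so $(\wp')^2=4\wp^3-g_2\wp-g_3$. For $j\ge0$, $\wp^{(j)}$ is the $j$-th derivative ($\wp^{(0)}=\wp$), and $\wp^{(-2)}\equiv1$; the index $-2$ counts as even. $\mathbb{N}=\{0,1,2,\ldots\}$. Standing setup: $m,\ell\ge1$; $n_1,\ldots,n_m$ pairwise distinct in $\mathbb{N}\cup\{-2\}$, $k_1,\ldots,k_\ell$ pairwise distinct in $\mathbb{N}\cup\{-2\}$, with $\ell=\max(\max_i n_i,\max_i k_i)+1$; $\gamma_1,\ldots,\gamma_m\in\mathbb{C}$; $z_1,\ldots,z_\ell\in\mathbb{C}\setminus\Lambda$ with $\det(\wp^{(k_j)}(z_i))_{i,j=1}^\ell\ne0$;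 $\lambda_1,\ldots,\lambda_\ell$ the unique solution of $\sum_{i=1}^m\gamma_i\wp^{(n_i)}(z_j)=\sum_{i=1}^\ell\lambda_i\wp^{(k_i)}(z_j)$, $j=1,\ldots,\ell$; $z=z_1+\cdots+z_\ell\notin\Lambda$; and $\psi(s)=\sum_i\gamma_i\wp^{(n_i)}(s)-\sum_i\lambda_i\wp^{(k_i)}(s)$ has a pole of order exactly $\ell+1$ at $0$ (the total coefficient of $\wp^{(\ell-1)}$ in $\psi$ is nonzero). Define $\varphi(s)=\big(\sum_{n_i\text{ odd}}\gamma_i\wp^{(n_i)}(s)-\sum_{k_i\text{ odd}}\lambda_i\wp^{(k_i)}(s)\big)^2-\big(\sum_{n_i\text{ even}}\gamma_i\wp^{(n_i)}(s)-\sum_{k_i\text{ even}}\lambda_i\wp^{(k_i)}(s)\big)^2$; it is a polynomial in $\wp(s)$ of degree at most $\ell+1$, and $\mu(0),\ldots,\mu(\ell+1)\in\mathbb{C}$ denote its coefficients: $\varphi(s)=\sum_{r=0}^{\ell+1}\mu(r)\wp(s)^r$. $S_r(x_1,\ldots,x_N)=\sum_{1\le i_1<\cdots<i_r\le N}x_{i_1}\cdots x_{i_r}$ is the $r$-th elementary symmetric polynomial, $S_0=1$, $S_r=0$ for $r>N$. *)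

theory Defs
  imports "HOL-Analysis.Infinite_Sum" "HOL-Analysis.Derivative" "Jordan_Normal_Form.Determinant"
begin

definition lattice :: "complex \<Rightarrow> complex \<Rightarrow> complex set" where
  "lattice w1 w2 = {2 * of_int a * w1 + 2 * of_int b * w2 | a b :: int. True}"

text \<open>Weierstrass elliptic function of the lattice (values at lattice points are irrelevant).\<close>
definition wp :: "complex \<Rightarrow> complex \<Rightarrow> complex \<Rightarrow> complex" where
  "wp w1 w2 z = 1 / z^2 + (\<Sum>\<^sub>\<infinity> w \<in> lattice w1 w2 - {0}. 1 / (z - w)^2 - 1 / w^2)"

text \<open>wp^(j) for j >= 0 (j-th derivative), and wp^(-2) = 1. Index -1 is never used.\<close>
definition wpd :: "complex \<Rightarrow> complex \<Rightarrow> int \<Rightarrow> complex \<Rightarrow> complex" where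
  "wpd w1 w2 j s = (if j = -2 then 1 else (deriv ^^ nat j) (wp w1 w2) s)"

definition esym :: "nat \<Rightarrow> complex list \<Rightarrow> complex" where
  "esym r xs = (\<Sum>I \<in> {I. I \<subseteq> {0..<length xs} \<and> card I = r}. \<Prod>i\<in>I. xs ! i)"

end

theory Submission
  imports "HOL-Complex_Analysis.Complex_Analysis" Defs
begin

text \<open>
  Write \<open>\<psi> = A + B\<close> with \<open>A\<close> and \<open>B\<close> the combinations of derivatives of odd and of even order. By
  parity \<open>\<psi> (- s) = B s - A s\<close>, so \<open>\<phi> s = - \<psi> s * \<psi> (- s)\<close>. The elliptic function \<open>\<psi>\<close> has no pole outside
  the lattice, has order at most \<open>l + 1\<close> at \<open>0\<close> and vanishes at \<open>z\<^sub>1, \<dots>, z\<^sub>l\<close>, hence also at \<open>- z\<close>, by Abel's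
  theorem: for a theta function \<open>\<theta>\<close> with simple zeros at the lattice, the quotient of
  \<open>\<psi> s * \<theta> s ^ (l + 1)\<close> by \<open>\<theta> (s + z) * \<Prod> \<theta> (s - z\<^sub>i)\<close> is elliptic with at most one simple pole modulo the
  lattice, so it is constant. The same factorization applied to \<open>wp s - wp a\<close> shows that \<open>wp\<close> separates
  points up to sign. Thus \<open>\<phi>\<close>, as a polynomial of degree at most \<open>l + 1\<close> in \<open>wp\<close>, has \<open>l + 1\<close> distinct known
  roots, and Vieta's formulas apply.
\<close>

section \<open>Period lattices\<close>

text \<open>Abel's theorem is usually read off from contour integrals around a period parallelogram.
  Here Liouville's theorem takes their place, and this shapes the statements. The theta quotient is
  periodic only if the zeros of its denominator add up to exactly 0, so the last one is minus the
  sum of the others; hence the extra zero of \<psi> appears at \<open>- z\<close>, and only the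
  symmetry of \<phi> under \<open>s \<mapsto> - s\<close> turns it into the root
  \<open>wp z\<close>. The denominator should have simple zeros off the lattice:
  \<open>z \<notin> L\<close> and \<open>z + z_i \<notin> L\<close> keep \<open>- z\<close> away
  from 0 and from the other zeros, and the nonvanishing determinant makes the \<open>z_i\<close>
  pairwise incongruent. For \<open>wp s - wp a\<close> the two zeros \<open>a\<close> and
  \<open>- a\<close> coincide when \<open>a\<close> is a half period, so that case gets an argument
  of its own. The exact degree of \<phi> in \<open>wp\<close> comes from counting roots of a nonzero
  polynomial.\<close>

lemma summable_on_int_powr: "(\<lambda>a :: int. (1 + \<bar>real_of_int a\<bar>) powr (- 3/2)) summable_on UNIV"
proof -
  let ?f = "\<lambda>a :: int. (1 + \<bar>real_of_int a\<bar>) powr (- 3/2)"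
  have "summable (\<lambda>n. real n powr (- 3/2))" by (subst summable_real_powr_iff) auto
  hence "summable (\<lambda>n. real (Suc n) powr (- 3/2))" by (subst summable_Suc_iff)
  hence S: "(\<lambda>n. real (Suc n) powr (- 3/2)) summable_on UNIV"
    by (intro summable_nonneg_imp_summable_on) auto
  have "?f summable_on range int"
    using S by (subst summable_on_reindex) (auto simp: o_def add.commute)
  moreover have "?f summable_on range (\<lambda>n. - int n)"
    using S by (subst summable_on_reindex) (auto simp: o_def add.commute inj_on_def)
  ultimately have "?f summable_on (range int \<union> (range (\<lambda>n. - int n) - range int))"
    by (intro summable_on_Un_disjoint) (auto intro: summable_on_subset_banach)
  moreover have "range int \<union> (range (\<lambda>n. - int n) - range int) = UNIV"
  proof -
    have "x \<in> range int \<or> x \<in> range (\<lambda>n. - int n)" for x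
      by (cases x rule: int_cases2) auto
    thus ?thesis by auto
  qed
  ultimately show ?thesis by simp
qed

section \<open>Periodicity of derivatives, of functions with removed singularities, and of
  limits\<close>

lemma deriv_periodic:
  assumes "\<And>s. f (s + c) = f s"
  shows "deriv f (s + c) = deriv f s"
proof -
  have "(\<lambda>x. f (x + c)) = f" using assms by auto
  thus ?thesis unfolding deriv_def by (simp add: DERIV_shift)
qed

lemma remove_sings_periodic:
  assumes "\<And>s. f (s + c) = f s"
  shows "remove_sings f (s + c) = remove_sings f s"
proof -
  have "filtermap (\<lambda>x. x + c) (at s) = at (s + c)"
    using filtermap_at_shift[of "- c" s] by simp
  hence "remove_sings (f \<circ> (\<lambda>x. x + c)) s = remove_sings f (s + c)"
    by (rule remove_sings_compose)
  moreover have "f \<circ> (\<lambda>x. x + c) = f" using assms by (auto simp: o_def)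
  ultimately show ?thesis by simp
qed

lemma tendsto_shift_periodic:
  fixes f :: "complex \<Rightarrow> complex"
  assumes "\<And>s. f (s + w) = f s" "(f \<longlongrightarrow> c) (at p)"
  shows "(f \<longlongrightarrow> c) (at (p + w))"
proof -
  have "f (x + (p + w)) = f (x + p)" for x using assms(1)[of "x + p"] by (simp add: add.assoc)
  thus ?thesis
    using assms(2) unfolding filterlim_at_to_0[of f _ p] filterlim_at_to_0[of f _ "p + w"] by simp
qed

section \<open>The lattice as a discrete subgroup of the plane\<close>

locale half_periods =
  fixes w1 w2 :: complex
  assumes Im_ratio_pos: "Im (w2 / w1) > 0"
begin

abbreviation "L \<equiv> lattice w1 w2"

lemma w1_nonzero: "w1 \<noteq> 0"
  using Im_ratio_pos by auto

lemma lattice_iff: "s \<in> L \<longleftrightarrow> (\<exists>a b :: int. s = 2 * of_int a * w1 + 2 * of_int b * w2)"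
  by (auto simp: lattice_def)

lemma zero_in_lattice [simp]: "0 \<in> L"
  unfolding lattice_iff by (intro exI[of _ 0]) simp

lemma lattice_add [intro]:
  assumes "u \<in> L" "v \<in> L" shows "u + v \<in> L"
proof -
  obtain a b c d :: int where "u = 2 * of_int a * w1 + 2 * of_int b * w2" "v = 2 * of_int c * w1 + 2 * of_int d * w2"
    using assms unfolding lattice_iff by blast
  hence "u + v = 2 * of_int (a + c) * w1 + 2 * of_int (b + d) * w2"
    by (simp add: algebra_simps)
  thus ?thesis unfolding lattice_iff by blast
qed

lemma lattice_uminus_iff [simp]: "- u \<in> L \<longleftrightarrow> u \<in> L"
proof -
  have "- u \<in> L" if u: "u \<in> L" for u
  proof -
    obtain a b :: int where "u = 2 * of_int a * w1 + 2 * of_int b * w2"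
      using u unfolding lattice_iff by blast
    hence "- u = 2 * of_int (- a) * w1 + 2 * of_int (- b) * w2"
      by (simp add: algebra_simps)
    thus ?thesis unfolding lattice_iff by blast
  qed
  from this[of u] this[of "- u"] show ?thesis by auto
qed

lemma lattice_diff [intro]: "u \<in> L \<Longrightarrow> v \<in> L \<Longrightarrow> u - v \<in> L"
  using lattice_add[of u "- v"] by simp

lemma lattice_add_right_iff [simp]: "w \<in> L \<Longrightarrow> s + w \<in> L \<longleftrightarrow> s \<in> L"
  using lattice_add lattice_diff[of "s + w" w] by auto

lemma lattice_diff_commute: "u - v \<in> L \<longleftrightarrow> v - u \<in> L"
  using lattice_uminus_iff[of "u - v"] by simp

lemma generators_in_lattice [simp]: "2 * w1 \<in> L" "2 * w2 \<in> L"
proof -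
  have "2 * w1 = 2 * of_int 1 * w1 + 2 * of_int 0 * w2" "2 * w2 = 2 * of_int 0 * w1 + 2 * of_int 1 * w2"
    by auto
  thus "2 * w1 \<in> L" "2 * w2 \<in> L" unfolding lattice_iff by blast+
qed

text \<open>Dividing by \<open>2 * w1\<close> turns a lattice point into
  \<open>a + b * \<tau>\<close>. Its imaginary part controls \<open>b\<close> because
  \<open>Im \<tau> > 0\<close>, and the triangle inequality then controls \<open>a\<close>.
  Discreteness of the lattice, independence of its generators and convergence of the lattice sums
  all rest on this estimate.\<close>

lemma lattice_norm_lower_bound:
  obtains c :: real where "c > 0"
    and "\<And>a b :: int. norm (2 * of_int a * w1 + 2 * of_int b * w2) \<ge> c * (\<bar>a\<bar> + \<bar>b\<bar>)"
proof -
  define \<tau> where "\<tau> = w2 / w1"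
  define y where "y = Im \<tau>"
  have y: "y > 0" using Im_ratio_pos by (simp add: y_def \<tau>_def)
  \<comment> \<open>The sum of the two bounds \<open>1 + norm \<tau> / y\<close> for
    \<open>\<bar>a\<bar>\<close> and \<open>1 / y\<close> for \<open>\<bar>b\<bar>\<close>, both
    relative to the norm of \<open>a + b * \<tau>\<close>.\<close>
  define C where "C = 1 + norm \<tau> / y + 1 / y"
  have C: "C > 0" using y by (simp add: C_def add_pos_nonneg)
  have bound: "\<bar>real_of_int a\<bar> + \<bar>real_of_int b\<bar> \<le> C * norm (of_int a + of_int b * \<tau>)" for a b :: int
  proof -
    define u where "u = of_int a + of_int b * \<tau>"
    have "Im u = b * y" by (simp add: u_def y_def)
    hence "\<bar>real_of_int b\<bar> * y \<le> norm u" using abs_Im_le_cmod[of u] y by (simp add: abs_mult)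
    hence b: "\<bar>real_of_int b\<bar> \<le> norm u / y" using y by (simp add: field_simps)
    have "of_int a = u - of_int b * \<tau>" by (simp add: u_def)
    hence "norm (of_int a :: complex) \<le> norm u + norm (of_int b * \<tau>)"
      using norm_triangle_ineq4 by metis
    hence "\<bar>real_of_int a\<bar> \<le> norm u + \<bar>real_of_int b\<bar> * norm \<tau>" by (simp add: norm_mult)
    also have "\<bar>real_of_int b\<bar> * norm \<tau> \<le> norm u / y * norm \<tau>"
      using b by (intro mult_right_mono) auto
    finally show ?thesis using b unfolding C_def u_def[symmetric] by (simp add: algebra_simps)
  qed
  define c where "c = 2 * norm w1 / C"
  show ?thesis
  proof (rule that[of c])
    show "c > 0" using C w1_nonzero by (simp add: c_def)
    fix a b :: int
    have "2 * of_int a * w1 + 2 * of_int b * w2 = 2 * w1 * (of_int a + of_int b * \<tau>)"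
      using w1_nonzero by (simp add: \<tau>_def field_simps)
    hence "norm (2 * of_int a * w1 + 2 * of_int b * w2) = 2 * norm w1 * norm (of_int a + of_int b * \<tau>)"
      by (simp add: norm_mult)
    also have "\<dots> \<ge> 2 * norm w1 * ((\<bar>real_of_int a\<bar> + \<bar>real_of_int b\<bar>) / C)"
      using bound[of a b] C by (intro mult_left_mono) (auto simp: field_simps)
    finally show "norm (2 * of_int a * w1 + 2 * of_int b * w2) \<ge> c * (\<bar>a\<bar> + \<bar>b\<bar>)"
      by (simp add: c_def)
  qed
qed

lemma finite_lattice_bounded: "finite {w \<in> L. norm w \<le> R}"
proof -
  obtain c :: real where c: "c > 0"
    and bd: "\<And>a b :: int. norm (2 * of_int a * w1 + 2 * of_int b * w2) \<ge> c * (\<bar>a\<bar> + \<bar>b\<bar>)"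
    using lattice_norm_lower_bound by blast
  define N where "N = \<lceil>R / c\<rceil>"
  have "{w \<in> L. norm w \<le> R} \<subseteq> (\<lambda>(a, b). 2 * of_int a * w1 + 2 * of_int b * w2) ` ({-N..N} \<times> {-N..N})"
  proof
    fix w assume w: "w \<in> {w \<in> L. norm w \<le> R}"
    then obtain a b :: int where ab: "w = 2 * of_int a * w1 + 2 * of_int b * w2"
      unfolding lattice_iff by blast
    have "c * (\<bar>a\<bar> + \<bar>b\<bar>) \<le> R" using bd[of a b] w ab by auto
    hence "real_of_int (\<bar>a\<bar> + \<bar>b\<bar>) \<le> R / c" using c by (simp add: field_simps)
    hence "\<bar>a\<bar> + \<bar>b\<bar> \<le> N" unfolding N_def by linarith
    hence "(a, b) \<in> {-N..N} \<times> {-N..N}" by auto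
    thus "w \<in> (\<lambda>(a, b). 2 * of_int a * w1 + 2 * of_int b * w2) ` ({-N..N} \<times> {-N..N})"
      using ab by force
  qed
  thus ?thesis by (rule finite_subset) auto
qed

lemma countable_lattice: "countable L"
proof -
  have "L = (\<lambda>(a, b). 2 * of_int a * w1 + 2 * of_int b * w2) ` (UNIV :: (int \<times> int) set)"
    unfolding lattice_def by force
  thus ?thesis by (metis countable_image countableI_type)
qed

lemma eventually_not_in_lattice: "eventually (\<lambda>s. s - a \<notin> L) (at p)"
proof -
  \<comment> \<open>If \<open>s\<close> is within distance 1 of \<open>p\<close>, then
    \<open>s - a\<close> lies in this bounded region, so only finitely many lattice points have to
    be avoided. The point \<open>p - a\<close> is left out because \<open>p\<close> itself may lie
    on the translated lattice.\<close>
  define F where "F = {w \<in> L. norm w \<le> norm (p - a) + 1} - {p - a}"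
  have "finite F" unfolding F_def using finite_lattice_bounded by auto
  hence "open (- ((\<lambda>w. w + a) ` F))" by (intro open_Compl finite_imp_closed finite_imageI)
  moreover have "p \<in> - ((\<lambda>w. w + a) ` F)" by (auto simp: F_def)
  ultimately have "eventually (\<lambda>s. s \<in> - ((\<lambda>w. w + a) ` F)) (nhds p)"
    by (rule eventually_nhds_in_open)
  hence "eventually (\<lambda>s. s \<in> - ((\<lambda>w. w + a) ` F)) (at p)"
    by (auto simp: eventually_at_filter elim: eventually_mono)
  moreover have "eventually (\<lambda>s. s \<in> ball p 1 - {p}) (at p)"
    by (intro eventually_at_in_open) auto
  ultimately show ?thesis
  proof eventually_elim
    case (elim s)
    show ?case
    proof
      assume s: "s - a \<in> L"
      have "norm (s - a) \<le> norm (p - a) + norm (s - p)"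
        using norm_triangle_ineq[of "p - a" "s - p"] by simp
      also have "norm (s - p) \<le> 1" using elim by (simp add: dist_norm norm_minus_commute)
      finally have "s - a \<in> F" using s elim by (auto simp: F_def)
      hence "s \<in> (\<lambda>w. w + a) ` F" by force
      thus False using elim by simp
    qed
  qed
qed

lemma closed_lattice: "closed L"
proof -
  have "\<not> p islimpt L" for p
    using eventually_not_in_lattice[of 0 p]
    unfolding islimpt_iff_eventually by simp
  thus ?thesis by (simp add: closed_limpt)
qed

lemma open_complement_lattice: "open (- L)"
  using closed_lattice by auto

lemma connected_complement_lattice: "connected (- L)"
  by (intro path_connected_imp_connected path_connected_complement_countable countable_lattice) auto

text \<open>The inequality \<open>sqrt (A * B) \<le> A + B - 1\<close> bounds the cubed reciprocal
  norm by a product of one-dimensional terms with exponent 3/2, which is still greater than 1. The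
  double series thus reduces to the product of two convergent single series.\<close>

lemma lattice_summable: "(\<lambda>w. 1 / norm w ^ 3) summable_on L"
proof -
  obtain c :: real where c: "c > 0"
    and bd: "\<And>a b :: int. norm (2 * of_int a * w1 + 2 * of_int b * w2) \<ge> c * (\<bar>a\<bar> + \<bar>b\<bar>)"
    using lattice_norm_lower_bound by blast
  define W where "W = (\<lambda>(a :: int, b :: int). 2 * of_int a * w1 + 2 * of_int b * w2)"
  define f where "f = (\<lambda>a :: int. (1 + \<bar>real_of_int a\<bar>) powr (- 3/2))"
  have f: "f summable_on UNIV" unfolding f_def by (rule summable_on_int_powr)
  have W: "inj W"
  proof (rule injI)
    fix x y assume "W x = W y"
    moreover obtain a b c' d where "x = (a, b)" "y = (c', d)" by fastforce
    ultimately have "2 * of_int (a - c') * w1 + 2 * of_int (b - d) * w2 = 0"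
      by (simp add: W_def algebra_simps)
    hence "c * (\<bar>a - c'\<bar> + \<bar>b - d\<bar>) \<le> 0" using bd[of "a - c'" "b - d"] by simp
    hence "real_of_int (\<bar>a - c'\<bar> + \<bar>b - d\<bar>) \<le> 0" using c by (simp add: mult_le_0_iff)
    hence "a = c' \<and> b = d" by linarith
    thus "x = y" using \<open>x = _\<close> \<open>y = _\<close> by simp
  qed
  have rW: "range W = L" unfolding W_def lattice_def by force
  have "(\<lambda>(a, b). f a * f b) summable_on (Sigma UNIV (\<lambda>_. UNIV))"
  proof (rule summable_on_SigmaI[where g = "\<lambda>a. f a * infsum f UNIV"])
    show "((\<lambda>y. case (x, y) of (a, b) \<Rightarrow> f a * f b) has_sum f x * infsum f UNIV) UNIV" for x
      using has_sum_cmult_right[OF has_sum_infsum[OF f]] by simp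
    show "(\<lambda>a. f a * infsum f UNIV) summable_on UNIV"
      by (intro summable_on_cmult_left f)
  qed (auto simp: f_def)
  hence "(\<lambda>x. (2 / c) ^ 3 * (case x of (a, b) \<Rightarrow> f a * f b)) summable_on UNIV"
    by (intro summable_on_cmult_right) simp
  hence "(\<lambda>x. 1 / norm (W x) ^ 3) summable_on UNIV"
  proof (rule summable_on_comparison_test)
    fix x :: "int \<times> int"
    obtain a b where x: "x = (a, b)" by fastforce
    show "1 / norm (W x) ^ 3 \<le> (2 / c) ^ 3 * (case x of (a, b) \<Rightarrow> f a * f b)"
    proof (cases "x = (0, 0)")
      \<comment> \<open>Since \<open>1 / 0 = 0\<close>, the origin contributes nothing and may stay
        in the index set.\<close>
      case True
      thus ?thesis using c by (simp add: W_def f_def)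
    next
      case False
      define A where "A = 1 + \<bar>real_of_int a\<bar>"
      define B where "B = 1 + \<bar>real_of_int b\<bar>"
      have A: "A \<ge> 1" and B: "B \<ge> 1" by (auto simp: A_def B_def)
      have "\<bar>a\<bar> + \<bar>b\<bar> \<ge> 1" using False x by auto
      hence ab: "real_of_int (\<bar>a\<bar> + \<bar>b\<bar>) \<ge> 1" by linarith
      have "(A * B) powr (1/2) \<le> A + B - 1"
      proof -
        have "A * B \<le> (A + B - 1) ^ 2"
        proof -
          have "(A + B - 1)^2 - A * B = (A - 1)^2 + (B - 1)^2 + (A - 1) * (B - 1) + (A - 1) + (B - 1)"
            by (simp add: power2_eq_square algebra_simps)
          also have "\<dots> \<ge> 0"
            using A B by (intro add_nonneg_nonneg mult_nonneg_nonneg zero_le_power2) auto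
          finally show ?thesis by simp
        qed
        hence "(A * B) powr (1/2) \<le> ((A + B - 1)^2) powr (1/2)"
          using A B by (intro powr_mono2) auto
        also have "\<dots> = A + B - 1" using A B by (simp add: powr_half_sqrt)
        finally show ?thesis .
      qed
      \<comment> \<open>Here \<open>A + B - 1\<close> is
        \<open>1 + \<bar>a\<bar> + \<bar>b\<bar>\<close>; the summand 1 is absorbed because
        \<open>(a, b)\<close> is not the origin, and this is the source of the factor 2 in
        \<open>2 / c\<close>.\<close>
      also have "A + B - 1 \<le> 2 * (\<bar>real_of_int a\<bar> + \<bar>real_of_int b\<bar>)"
        using ab by (simp add: A_def B_def)
      also have "\<dots> \<le> (2 / c) * norm (W x)"
        using bd[of a b] c by (simp add: x W_def field_simps)
      finally have le: "(A * B) powr (1/2) \<le> (2 / c) * norm (W x)" .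
      have "((A * B) powr (1/2)) ^ 3 \<le> ((2 / c) * norm (W x)) ^ 3"
        by (intro power_mono le) auto
      moreover have "((A * B) powr (1/2)) ^ 3 = (A * B) powr (3/2)"
        using A B by (simp add: powr_powr flip: powr_realpow')
      ultimately have "(A * B) powr (3/2) \<le> (2 / c) ^ 3 * norm (W x) ^ 3"
        by (simp add: power_mult_distrib power_divide)
      moreover have pos: "(A * B) powr (3/2) > 0" using A B by simp
      moreover have "norm (W x) \<noteq> 0" using calculation by auto
      ultimately have "1 / norm (W x) ^ 3 \<le> (2 / c) ^ 3 * (1 / (A * B) powr (3/2))"
        using c by (simp add: divide_simps mult.commute)
      also have "1 / (A * B) powr (3/2) = f a * f b"
        using A B by (simp add: f_def powr_mult powr_minus divide_simps flip: A_def B_def)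
      finally show ?thesis by (simp add: x)
    qed
  qed auto
  hence "((\<lambda>w. 1 / norm w ^ 3) \<circ> W) summable_on UNIV" by (simp add: o_def)
  thus ?thesis using summable_on_reindex[OF W] rW by metis
qed

section \<open>The Weierstrass elliptic function\<close>

definition wterm :: "complex \<Rightarrow> complex \<Rightarrow> complex" where
  "wterm s w = 1 / (s - w)^2 - 1 / w^2"

text \<open>Over a common denominator the leading terms cancel and leave
  \<open>s * (2 * w - s) / ((s - w)^2 * w^2)\<close>, of third order in \<open>1 / w\<close>. The
  condition \<open>norm w \<ge> 2 * R\<close> gives \<open>norm (s - w) \<ge> norm w / 2\<close> and
  \<open>norm (2 * w - s) \<le> 5/2 * norm w\<close>, hence the constant 10 = 4 * 5/2.\<close>

lemma norm_wterm_le: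
  assumes "R > 0" "norm s \<le> R" "norm w \<ge> 2 * R"
  shows "norm (wterm s w) \<le> 10 * R * (1 / norm w ^ 3)"
proof -
  define x where "x = norm w"
  have x: "x > 0" and w: "w \<noteq> 0" using assms by (auto simp: x_def)
  have sw: "norm (s - w) \<ge> x / 2"
    using assms norm_triangle_ineq2[of w s] by (simp add: x_def norm_minus_commute)
  hence sw0: "s - w \<noteq> 0" using x by auto
  have "wterm s w = s * (2 * w - s) / ((s - w)^2 * w^2)"
    using w sw0 by (simp add: wterm_def divide_simps) (simp add: algebra_simps power2_eq_square)
  hence "norm (wterm s w) = norm s * norm (2 * w - s) / (norm (s - w)^2 * x^2)"
    by (simp add: norm_mult norm_divide norm_power x_def)
  also have "\<dots> \<le> R * (5 / 2 * x) / ((x / 2)^2 * x^2)"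
  proof (intro frac_le mult_mono power_mono sw)
    have "norm (2 * w - s) \<le> 2 * x + norm s"
      using norm_triangle_ineq4[of "2 * w" s] by (simp add: norm_mult x_def)
    thus "norm (2 * w - s) \<le> 5 / 2 * x" using assms by (simp add: x_def)
  qed (use assms x in auto)
  also have "\<dots> = 10 * R * (1 / x ^ 3)"
    using x by (simp add: field_simps power2_eq_square power3_eq_cube)
  finally show ?thesis by (simp add: x_def)
qed

lemma finite_lattice_ball: "finite {w \<in> L. norm w < R}"
  by (rule finite_subset[OF _ finite_lattice_bounded[of R]]) auto

lemma summable_wterm_bound: "(\<lambda>w. 10 * R * (1 / norm w ^ 3)) summable_on {w \<in> L. norm w \<ge> 2 * R}"
  by (intro summable_on_cmult_right summable_on_subset_banach[OF lattice_summable]) auto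

lemma summable_wterm: "wterm s summable_on L"
proof -
  define R where "R = norm s + 1"
  have R: "R > 0" "norm s \<le> R" by (auto simp: R_def add_nonneg_pos)
  have "(\<lambda>w. norm (wterm s w)) summable_on {w \<in> L. norm w \<ge> 2 * R}"
    by (rule Infinite_Sum.abs_summable_on_comparison_test'[OF summable_wterm_bound]) (use R norm_wterm_le in auto)
  hence "wterm s summable_on {w \<in> L. norm w \<ge> 2 * R}"
    by (rule abs_summable_summable)
  moreover have "wterm s summable_on {w \<in> L. norm w < 2 * R}"
    by (rule summable_on_finite[OF finite_lattice_ball])
  ultimately have "wterm s summable_on {w \<in> L. norm w < 2 * R} \<union> {w \<in> L. norm w \<ge> 2 * R}"
    by (intro summable_on_Un_disjoint) auto
  moreover have "{w \<in> L. norm w < 2 * R} \<union> {w \<in> L. norm w \<ge> 2 * R} = L" by auto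
  ultimately show ?thesis by simp
qed

text \<open>The convention \<open>1 / 0 = 0\<close> makes \<open>1 / s^2\<close> the summand for the lattice point 0.\<close>
lemma wp_eq_infsum: "wp w1 w2 s = infsum (wterm s) L"
proof -
  have "infsum (wterm s) L = infsum (wterm s) (insert 0 (L - {0}))"
    by (simp add: insert_absorb)
  also have "\<dots> = wterm s 0 + infsum (wterm s) (L - {0})"
    by (intro infsum_insert summable_on_subset_banach[OF summable_wterm]) auto
  finally show ?thesis by (simp add: wp_def wterm_def[abs_def])
qed

text \<open>Cutting the series at norm \<open>2 * R\<close> puts all poles inside the ball into a
  finite sum, while the tail converges uniformly by the Weierstrass test. Both the holomorphy off
  the lattice and the principal part at 0 are read off from this decomposition.\<close>

lemma wp_local_expansion:
  assumes "R > 0"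
  obtains h where "h holomorphic_on ball 0 R"
    "\<And>s. s \<in> ball 0 R \<Longrightarrow> wp w1 w2 s = (\<Sum>w\<in>{w \<in> L. norm w < 2 * R}. wterm s w) + h s"
proof -
  define G where "G = {w \<in> L. norm w \<ge> 2 * R}"
  define F where "F = {w \<in> L. norm w < 2 * R}"
  define h where "h = (\<lambda>s. \<Sum>\<^sub>\<infinity>w\<in>G. wterm s w)"
  have ul: "uniform_limit (cball 0 R) (\<lambda>X s. \<Sum>w\<in>X. wterm s w) h (finite_subsets_at_top G)"
    unfolding h_def
  proof (rule Weierstrass_m_test_general)
    show "norm (wterm y x) \<le> 10 * R * (1 / norm x ^ 3)" if "x \<in> G" "y \<in> cball 0 R" for x y
      using that assms by (intro norm_wterm_le) (auto simp: G_def)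
    show "(\<lambda>w. 10 * R * (1 / norm w ^ 3)) summable_on G"
      unfolding G_def by (rule summable_wterm_bound)
  qed
  have hol: "(\<lambda>s. \<Sum>w\<in>X. wterm s w) holomorphic_on cball 0 R" if "X \<subseteq> G" for X
  proof (rule holomorphic_on_sum)
    fix w assume "w \<in> X"
    hence w: "norm w \<ge> 2 * R" using that by (auto simp: G_def)
    have ne: "(s - w)\<^sup>2 \<noteq> 0" if s: "s \<in> cball 0 R" for s
    proof
      assume "(s - w)\<^sup>2 = 0"
      hence "s = w" by simp
      thus False using s w assms by simp
    qed
    have "(\<lambda>s. (s - w)\<^sup>2) holomorphic_on cball 0 R" by (intro holomorphic_intros)
    hence "(\<lambda>s. 1 / (s - w)\<^sup>2) holomorphic_on cball 0 R"
      by (rule holomorphic_on_divide[OF holomorphic_on_const]) (rule ne)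
    hence "(\<lambda>s. 1 / (s - w)\<^sup>2 - 1 / w\<^sup>2) holomorphic_on cball 0 R"
      by (rule holomorphic_on_diff[OF _ holomorphic_on_const])
    thus "(\<lambda>s. wterm s w) holomorphic_on cball 0 R" by (simp add: wterm_def)
  qed
  have "h holomorphic_on ball 0 R"
  proof (rule holomorphic_uniform_limit[OF _ ul])
    show "\<forall>\<^sub>F X in finite_subsets_at_top G. continuous_on (cball 0 R) (\<lambda>s. \<Sum>w\<in>X. wterm s w)
            \<and> (\<lambda>s. \<Sum>w\<in>X. wterm s w) holomorphic_on ball 0 R"
      by (intro eventually_finite_subsets_at_top_weakI conjI
            holomorphic_on_imp_continuous_on[OF hol] holomorphic_on_subset[OF hol ball_subset_cball])
  qed auto
  moreover have "wp w1 w2 s = (\<Sum>w\<in>F. wterm s w) + h s" for s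
  proof -
    have "infsum (wterm s) (F \<union> G) = infsum (wterm s) F + infsum (wterm s) G"
      by (intro infsum_Un_disjoint summable_on_subset_banach[OF summable_wterm])
         (auto simp: F_def G_def)
    moreover have "F \<union> G = L" by (auto simp: F_def G_def)
    moreover have "infsum (wterm s) F = (\<Sum>w\<in>F. wterm s w)"
      unfolding F_def by (intro infsum_finite finite_lattice_ball)
    ultimately show ?thesis by (simp add: wp_eq_infsum h_def)
  qed
  ultimately show ?thesis using that unfolding F_def by blast
qed

lemma wp_holomorphic: "wp w1 w2 holomorphic_on - L"
proof -
  have "wp w1 w2 field_differentiable at s" if s: "s \<notin> L" for s
  proof -
    define R where "R = norm s + 1"
    have R: "R > 0" by (auto simp: R_def add_nonneg_pos)
    obtain h where h: "h holomorphic_on ball 0 R"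
      and eq: "\<And>s. s \<in> ball 0 R \<Longrightarrow> wp w1 w2 s = (\<Sum>w\<in>{w \<in> L. norm w < 2 * R}. wterm s w) + h s"
      using wp_local_expansion[OF R] by blast
    define U where "U = ball 0 R \<inter> - L"
    have U: "open U" "s \<in> U" unfolding U_def using open_complement_lattice s by (auto simp: R_def)
    have "(\<lambda>s. (\<Sum>w\<in>{w \<in> L. norm w < 2 * R}. wterm s w) + h s) holomorphic_on U"
    proof (rule holomorphic_on_add[OF holomorphic_on_sum holomorphic_on_subset[OF h]])
      fix w assume w: "w \<in> {w \<in> L. norm w < 2 * R}"
      have "(\<lambda>s. 1 / (s - w)\<^sup>2 - 1 / w\<^sup>2) holomorphic_on U"
        by (rule holomorphic_on_diff[OF holomorphic_on_divide holomorphic_on_const])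
           (use w in \<open>auto intro!: holomorphic_intros simp: U_def\<close>)
      thus "(\<lambda>s. wterm s w) holomorphic_on U" by (simp add: wterm_def)
    qed (auto simp: U_def)
    hence "wp w1 w2 holomorphic_on U"
      by (rule holomorphic_transform) (use eq in \<open>auto simp: U_def\<close>)
    thus ?thesis using U by (rule holomorphic_on_imp_differentiable_at)
  qed
  thus ?thesis
    using open_complement_lattice by (auto simp: holomorphic_on_def intro: field_differentiable_at_within)
qed

lemma wp_pole_expansion:
  obtains R h where "R > 0" "h holomorphic_on ball 0 R"
    "\<And>s. s \<in> ball 0 R \<Longrightarrow> wp w1 w2 s = 1 / s^2 + h s" "ball 0 R \<inter> L = {0}"
proof -
  obtain c :: real where c: "c > 0"
    and bd: "\<And>a b :: int. norm (2 * of_int a * w1 + 2 * of_int b * w2) \<ge> c * (\<bar>a\<bar> + \<bar>b\<bar>)"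
    using lattice_norm_lower_bound by blast
  \<comment> \<open>With radius \<open>c / 2\<close> the cut is at \<open>c\<close>, below which the
    norm estimate leaves no lattice point except 0; the finite sum is then the single term
    \<open>1 / s^2\<close>.\<close>
  have F: "{w \<in> L. norm w < 2 * (c / 2)} = {0}"
  proof -
    have "w = 0" if "w \<in> L" "norm w < c" for w
    proof -
      obtain a b :: int where w: "w = 2 * of_int a * w1 + 2 * of_int b * w2"
        using \<open>w \<in> L\<close> unfolding lattice_iff by blast
      have "c * (\<bar>a\<bar> + \<bar>b\<bar>) < c * 1" using bd[of a b] that w by simp
      hence "real_of_int (\<bar>a\<bar> + \<bar>b\<bar>) < 1" using c by (simp only: mult_less_cancel_left_pos)
      hence "a = 0 \<and> b = 0" by linarith
      thus ?thesis using w by simp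
    qed
    thus ?thesis using c by auto
  qed
  have R: "c / 2 > 0" using c by simp
  obtain h where h: "h holomorphic_on ball 0 (c / 2)"
    "\<And>s. s \<in> ball 0 (c / 2) \<Longrightarrow> wp w1 w2 s = (\<Sum>w\<in>{w \<in> L. norm w < 2 * (c / 2)}. wterm s w) + h s"
    using wp_local_expansion[OF R] by blast
  show ?thesis
  proof (rule that[OF R h(1)])
    show "wp w1 w2 s = 1 / s^2 + h s" if "s \<in> ball 0 (c / 2)" for s
      using h(2)[OF that] unfolding F by (simp add: wterm_def)
    have "ball 0 (c / 2) \<inter> L \<subseteq> {w \<in> L. norm w < 2 * (c / 2)}" using c by auto
    thus "ball 0 (c / 2) \<inter> L = {0}" using F c by auto
  qed
qed

section \<open>Parity and periodicity of the function and its derivatives\<close>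

lemma wp_minus: "wp w1 w2 (- s) = wp w1 w2 s"
proof -
  have "infsum (wterm (- s)) L = infsum (wterm s) L"
  proof (rule infsum_reindex_bij_witness[of L uminus uminus])
    fix w assume "w \<in> L"
    have "(s + w)^2 = (- s - w)^2" by (simp add: power2_eq_square algebra_simps)
    thus "wterm s (- w) = wterm (- s) w" by (simp add: wterm_def)
  qed auto
  thus ?thesis by (simp add: wp_eq_infsum)
qed

text \<open>Differences of two values of \<open>wp\<close> are given by a series whose terms are translated into each
  other by the lattice; the remaining additive constant vanishes by evenness at \<open>- c / 2\<close>.\<close>
lemma wp_periodic:
  assumes c: "c \<in> L"
  shows "wp w1 w2 (s + c) = wp w1 w2 s"
proof -
  have diff: "wp w1 w2 a - wp w1 w2 b = (\<Sum>\<^sub>\<infinity>w\<in>L. 1 / (a - w)^2 - 1 / (b - w)^2)" for a b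
  proof -
    have "wp w1 w2 a - wp w1 w2 b = (\<Sum>\<^sub>\<infinity>w\<in>L. wterm a w - wterm b w)"
      unfolding wp_eq_infsum
      using infsum_add[OF summable_wterm[of a] summable_on_uminus[THEN iffD2, OF summable_wterm[of b]]]
      by (simp add: infsum_uminus)
    thus ?thesis by (simp add: wterm_def)
  qed
  have shift: "wp w1 w2 (a + c) - wp w1 w2 (b + c) = wp w1 w2 a - wp w1 w2 b" for a b
    unfolding diff
  proof (rule infsum_reindex_bij_witness[of L "\<lambda>w. w + c" "\<lambda>w. w - c"])
    fix w assume "w \<in> L"
    thus "w - c \<in> L" using c by blast
  qed (use c in \<open>auto simp: algebra_simps\<close>)
  have "wp w1 w2 (- c / 2 + c) = wp w1 w2 (- (- c / 2))" by (simp add: field_simps)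
  also have "\<dots> = wp w1 w2 (- c / 2)" by (rule wp_minus)
  finally show ?thesis using shift[of s "- c / 2"] by simp
qed

lemma wpd_periodic:
  assumes "c \<in> L"
  shows "wpd w1 w2 j (s + c) = wpd w1 w2 j s"
proof -
  have "(deriv ^^ n) (wp w1 w2) (s + c) = (deriv ^^ n) (wp w1 w2) s" for n s
    by (induction n arbitrary: s) (simp_all add: wp_periodic assms deriv_periodic)
  thus ?thesis by (simp add: wpd_def)
qed

lemma wpd_holomorphic: "wpd w1 w2 j holomorphic_on - L"
proof -
  have "(\<lambda>s. (deriv ^^ n) (wp w1 w2) s) holomorphic_on - L" for n
    using wp_holomorphic open_complement_lattice by (rule holomorphic_higher_deriv)
  thus ?thesis unfolding wpd_def by (cases "j = -2") (auto intro!: holomorphic_intros)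
qed

lemma wpd_minus:
  assumes "s \<notin> L" "j = -2 \<or> j \<ge> 0"
  shows "wpd w1 w2 j (- s) = (if even j then 1 else -1) * wpd w1 w2 j s"
proof (cases "j = -2")
  case False
  have "(deriv ^^ nat j) (\<lambda>w. wp w1 w2 (-1 * w)) s = (-1) ^ nat j * (deriv ^^ nat j) (wp w1 w2) (-1 * s)"
    by (rule higher_deriv_compose_linear[OF wp_holomorphic open_complement_lattice open_complement_lattice])
       (use assms in auto)
  moreover have "(\<lambda>w. wp w1 w2 (-1 * w)) = wp w1 w2" by (simp add: wp_minus)
  ultimately have *: "(deriv ^^ nat j) (wp w1 w2) s = (-1) ^ nat j * (deriv ^^ nat j) (wp w1 w2) (- s)"
    by (metis mult_minus1)
  have "even j \<longleftrightarrow> even (nat j)" using False assms by (simp add: even_nat_iff)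
  thus ?thesis using * False by (auto simp: wpd_def)
qed (simp add: wpd_def)

section \<open>Pole orders at the origin\<close>

lemma wp_tendsto: "((\<lambda>s. s^2 * wp w1 w2 s) \<longlongrightarrow> 1) (at 0)"
proof -
  obtain R h where R: "R > 0" and h: "h holomorphic_on ball 0 R"
    and eq: "\<And>s. s \<in> ball 0 R \<Longrightarrow> wp w1 w2 s = 1 / s^2 + h s"
    using wp_pole_expansion by metis
  have "isCont h 0" using h R
    by (intro continuous_on_interior[OF holomorphic_on_imp_continuous_on]) auto
  hence "((\<lambda>s. 1 + s^2 * h s) \<longlongrightarrow> 1 + 0^2 * h 0) (at 0)"
    unfolding isCont_def by (intro tendsto_intros)
  hence "((\<lambda>s. 1 + s^2 * h s) \<longlongrightarrow> 1) (at 0)" by simp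
  moreover have "eventually (\<lambda>s. 1 + s^2 * h s = s^2 * wp w1 w2 s) (at 0)"
  proof -
    have "eventually (\<lambda>s. s \<in> ball 0 R - {0}) (at (0::complex))"
      using R by (intro eventually_at_in_open) auto
    thus ?thesis by eventually_elim (simp add: eq divide_simps algebra_simps)
  qed
  ultimately show ?thesis by (rule Lim_transform_eventually)
qed

text \<open>The induction carries a numerator \<open>u\<close> that is holomorphic across 0:
  differentiating \<open>u s / s ^ (n + 2)\<close> gives a quotient of the same shape with numerator
  \<open>s * deriv u s - (n + 2) * u s\<close> and one more power of \<open>s\<close> below.\<close>

lemma higher_deriv_wp_pole:
  obtains R u where "R > 0" "u holomorphic_on ball 0 R"
    "\<And>s. s \<in> ball 0 R - {0} \<Longrightarrow> (deriv ^^ n) (wp w1 w2) s = u s / s ^ (n + 2)"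
proof -
  obtain R h where R: "R > 0" and h: "h holomorphic_on ball 0 R"
    and eq: "\<And>s. s \<in> ball 0 R \<Longrightarrow> wp w1 w2 s = 1 / s^2 + h s"
    using wp_pole_expansion by metis
  have "\<exists>u. u holomorphic_on ball 0 R \<and> (\<forall>s\<in>ball 0 R - {0}. (deriv ^^ n) (wp w1 w2) s = u s / s ^ (n + 2))"
  proof (induction n)
    case 0
    show ?case
    proof (rule exI[of _ "\<lambda>s. 1 + s^2 * h s"], intro conjI ballI)
      show "(\<lambda>s. 1 + s^2 * h s) holomorphic_on ball 0 R" by (intro holomorphic_intros h)
      fix s assume s: "s \<in> ball 0 R - {0::complex}"
      have "(1 + s^2 * h s) / s ^ 2 = 1 / s^2 + h s"
        using s by (simp add: add_divide_distrib)
      moreover have "wp w1 w2 s = 1 / s^2 + h s" using eq[of s] s by blast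
      ultimately show "(deriv ^^ 0) (wp w1 w2) s = (1 + s^2 * h s) / s ^ (0 + 2)"
        by (simp only: funpow_0 add_0_left)
    qed
  next
    case (Suc n)
    then obtain u where u: "u holomorphic_on ball 0 R"
      and ueq: "\<And>s. s \<in> ball 0 R - {0} \<Longrightarrow> (deriv ^^ n) (wp w1 w2) s = u s / s ^ (n + 2)"
      by blast
    show ?case
    proof (rule exI[of _ "\<lambda>s. s * deriv u s - of_nat (n + 2) * u s"], intro conjI ballI)
      show "(\<lambda>s. s * deriv u s - of_nat (n + 2) * u s) holomorphic_on ball 0 R"
        by (intro holomorphic_intros u) auto
      fix s assume s: "s \<in> ball 0 R - {0::complex}"
      have "((deriv ^^ n) (wp w1 w2) has_field_derivative D) (at s) \<longleftrightarrow>
            ((\<lambda>s. u s / s ^ (n + 2)) has_field_derivative D) (at s)" for D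
      proof (rule DERIV_cong_ev)
        have "eventually (\<lambda>x. x \<in> ball 0 R - {0}) (nhds s)"
          using s by (intro eventually_nhds_in_open) auto
        thus "\<forall>\<^sub>F x in nhds s. (deriv ^^ n) (wp w1 w2) x = u x / x ^ (n + 2)"
          by eventually_elim (rule ueq)
      qed auto
      moreover have "((\<lambda>s. u s / s ^ (n + 2)) has_field_derivative
              (s * deriv u s - of_nat (n + 2) * u s) / s ^ (Suc n + 2)) (at s)"
      proof -
        have "(u has_field_derivative deriv u s) (at s)"
          using u s by (intro holomorphic_derivI[of _ "ball 0 R"]) auto
        moreover have "((\<lambda>s. s ^ (n + 2)) has_field_derivative of_nat (n + 2) * s ^ (n + 1)) (at s)"
          using DERIV_power[OF DERIV_ident, of "n + 2" s UNIV] by simp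
        ultimately have "((\<lambda>s. u s / s ^ (n + 2)) has_field_derivative
            (deriv u s * s ^ (n + 2) - u s * (of_nat (n + 2) * s ^ (n + 1))) / (s ^ (n + 2) * s ^ (n + 2))) (at s)"
          by (rule DERIV_divide) (use s in simp)
        also have "(deriv u s * s ^ (n + 2) - u s * (of_nat (n + 2) * s ^ (n + 1))) / (s ^ (n + 2) * s ^ (n + 2))
            = (s ^ (n + 1) * (s * deriv u s - of_nat (n + 2) * u s)) / (s ^ (n + 1) * s ^ (Suc n + 2))"
          by (intro arg_cong2[of _ _ _ _ "(/)"]) (simp_all add: algebra_simps)
        also have "\<dots> = (s * deriv u s - of_nat (n + 2) * u s) / s ^ (Suc n + 2)"
          using s by (intro mult_divide_mult_cancel_left) simp
        finally show ?thesis .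
      qed
      ultimately show "(deriv ^^ Suc n) (wp w1 w2) s
          = (s * deriv u s - of_nat (n + 2) * u s) / s ^ (Suc n + 2)"
        by (simp add: DERIV_imp_deriv)
    qed
  qed
  thus ?thesis using that R by blast
qed

text \<open>Existence of the limit encodes a pole of order at most \<open>N\<close>; the limit may
  be 0. The order \<open>j + 2\<close> also fits the index -2, where it is 0, so the constant
  function is covered by the same bound.\<close>

lemma wpd_tendsto:
  assumes "j = -2 \<or> j \<ge> 0" "j + 2 \<le> int N"
  shows "\<exists>c. ((\<lambda>s. s ^ N * wpd w1 w2 j s) \<longlongrightarrow> c) (at 0)"
proof (cases "j = -2")
  case True
  have "((\<lambda>s. s ^ N) \<longlongrightarrow> 0 ^ N) (at (0::complex))" by (intro tendsto_intros)
  thus ?thesis using True by (auto simp: wpd_def)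
next
  case False
  define n where "n = nat j"
  have N: "N = (N - (n + 2)) + (n + 2)" using assms False by (simp add: n_def)
  obtain R u where R: "R > 0" and u: "u holomorphic_on ball 0 R"
    and eq: "\<And>s. s \<in> ball 0 R - {0} \<Longrightarrow> (deriv ^^ n) (wp w1 w2) s = u s / s ^ (n + 2)"
    using higher_deriv_wp_pole by blast
  have "isCont u 0" using u R
    by (intro continuous_on_interior[OF holomorphic_on_imp_continuous_on]) auto
  hence "((\<lambda>s. s ^ (N - (n + 2)) * u s) \<longlongrightarrow> 0 ^ (N - (n + 2)) * u 0) (at 0)"
    unfolding isCont_def by (intro tendsto_intros)
  moreover have "eventually (\<lambda>s. s ^ (N - (n + 2)) * u s = s ^ N * wpd w1 w2 j s) (at 0)"
  proof -
    have "eventually (\<lambda>s. s \<in> ball 0 R - {0}) (at (0::complex))"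
      using R by (intro eventually_at_in_open) auto
    thus ?thesis
    proof eventually_elim
      case (elim s)
      have "s ^ N = s ^ (N - (n + 2)) * s ^ (n + 2)" using arg_cong[OF N, of "\<lambda>k. s ^ k"] by (simp only: power_add)
      moreover have "wpd w1 w2 j s = u s / s ^ (n + 2)"
        using eq[OF elim] False by (simp add: wpd_def n_def)
      ultimately show ?case using elim by (simp del: power_add power_Suc)
    qed
  qed
  ultimately have "((\<lambda>s. s ^ N * wpd w1 w2 j s) \<longlongrightarrow> 0 ^ (N - (n + 2)) * u 0) (at 0)"
    by (rule Lim_transform_eventually)
  thus ?thesis by blast
qed

end

section \<open>A theta function\<close>

text \<open>The infinite q-Pochhammer symbol.\<close>

definition qprod :: "complex \<Rightarrow> complex \<Rightarrow> complex" where
  "qprod q y = (\<Prod>n. 1 - q ^ n * y)"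

lemma convergent_qprod:
  assumes "norm q < 1"
  shows "convergent_prod (\<lambda>n. 1 - q ^ n * y :: complex)"
proof -
  have "summable (\<lambda>n. norm q ^ n * norm y)"
    by (intro summable_mult2 summable_geometric) (use assms in simp)
  hence "summable (\<lambda>n. norm ((1 - q ^ n * y) - 1))"
    by (simp add: norm_mult norm_power)
  thus ?thesis
    by (intro abs_convergent_prod_imp_convergent_prod summable_imp_abs_convergent_prod)
qed

lemma qprod_rec:
  assumes "norm q < 1"
  shows "qprod q y = (1 - y) * qprod q (q * y)"
proof -
  have "(\<lambda>n. 1 - q ^ n * y) has_prod ((\<Prod>k<1. 1 - q ^ k * y) * (\<Prod>k. 1 - q ^ (k + 1) * y))"
    by (rule has_prod_ignore_initial_segment'[OF convergent_qprod[OF assms]])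
  moreover have "(\<lambda>k. 1 - q ^ (k + 1) * y) = (\<lambda>k. 1 - q ^ k * (q * y))"
    by (simp add: algebra_simps)
  ultimately show ?thesis
    unfolding qprod_def by (simp add: has_prod_iff)
qed

text \<open>Convergence of an infinite product includes that it is nonzero once all factors are
  nonzero, so the product can vanish only through one of its factors.\<close>

lemma qprod_eq_0_iff:
  assumes "norm q < 1"
  shows "qprod q y = 0 \<longleftrightarrow> (\<exists>n. q ^ n * y = 1)"
proof
  assume "qprod q y = 0"
  hence "\<not> (\<forall>i. 1 - q ^ i * y \<noteq> 0)"
    using prodinf_nonzero[OF convergent_qprod[OF assms, of y]] unfolding qprod_def by blast
  thus "\<exists>n. q ^ n * y = 1" by (metis right_minus_eq)
next
  assume "\<exists>n. q ^ n * y = 1"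
  then obtain n where "1 - q ^ n * y = 0" by force
  moreover have "(\<lambda>n. 1 - q ^ n * y) has_prod qprod q y"
    using convergent_qprod[OF assms] by (simp add: qprod_def convergent_prod_has_prod_iff)
  ultimately show "qprod q y = 0" using has_prod_zeroI by blast
qed

lemma qprod_holomorphic:
  assumes "norm q < 1"
  shows "qprod q holomorphic_on A"
proof -
  have "qprod q holomorphic_on UNIV"
  proof (rule holomorphic_uniform_sequence)
    show "(\<lambda>y. \<Prod>k<n. 1 - q ^ k * y) holomorphic_on UNIV" for n
      by (intro holomorphic_intros)
    fix x :: complex
    have "uniformly_convergent_on (cball x 1) (\<lambda>N y. \<Prod>n<N. 1 - q ^ n * y)"
    proof (rule uniformly_convergent_on_prod')
      show "uniformly_convergent_on (cball x 1) (\<lambda>N y. \<Sum>n<N. norm ((1 - q ^ n * y) - 1))"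
      proof (rule Weierstrass_m_test')
        show "norm (norm ((1 - q ^ n * y) - 1)) \<le> norm q ^ n * (norm x + 1)" if "y \<in> cball x 1" for n y
        proof -
          have "norm (y - x) \<le> 1" using that by (simp add: dist_norm norm_minus_commute)
          hence "norm y \<le> norm x + 1" using norm_triangle_sub[of y x] by linarith
          hence "norm q ^ n * norm y \<le> norm q ^ n * (norm x + 1)" by (intro mult_left_mono) auto
          thus ?thesis by (simp add: norm_mult norm_power)
        qed
        show "summable (\<lambda>n. norm q ^ n * (norm x + 1))"
          by (intro summable_mult2 summable_geometric) (use assms in simp)
      qed
    qed (auto intro!: continuous_intros)
    then obtain l where l: "uniform_limit (cball x 1) (\<lambda>N y. \<Prod>n<N. 1 - q ^ n * y) l sequentially"
      by (auto simp: uniformly_convergent_on_def)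
    have "l y = qprod q y" if "y \<in> cball x 1" for y
    proof -
      have "(\<lambda>N. \<Prod>n<N. 1 - q ^ n * y) \<longlonglongrightarrow> l y"
        using tendsto_uniform_limitI[OF l that] .
      \<comment> \<open>The uniform limit concerns products over \<open>n < N\<close>, the value of
        the infinite product is a limit over \<open>n \<le> N\<close>; the index is shifted by one
        to compare them.\<close>
      hence "(\<lambda>N. \<Prod>n<Suc N. 1 - q ^ n * y) \<longlonglongrightarrow> l y"
        by (rule LIMSEQ_Suc)
      moreover have "(\<lambda>N. \<Prod>n\<le>N. 1 - q ^ n * y) \<longlonglongrightarrow> qprod q y"
        unfolding qprod_def by (rule convergent_prod_LIMSEQ[OF convergent_qprod[OF assms]])
      ultimately show ?thesis by (simp only: lessThan_Suc_atMost) (rule LIMSEQ_unique)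
    qed
    hence "uniform_limit (cball x 1) (\<lambda>N y. \<Prod>n<N. 1 - q ^ n * y) (qprod q) sequentially"
      by (intro uniform_limit_cong'[OF refl, THEN iffD1, OF _ l])
    thus "\<exists>d>0. cball x d \<subseteq> UNIV \<and>
        uniform_limit (cball x d) (\<lambda>n y. \<Prod>k<n. 1 - q ^ k * y) (qprod q) sequentially"
      by (intro exI[of _ 1]) auto
  qed auto
  thus ?thesis by (rule holomorphic_on_subset) auto
qed

context half_periods begin

text \<open>With \<open>\<tau> = w2 / w1\<close> this is the square of Jacobi's nome
  \<open>exp (pi * \<i> * \<tau>)\<close>.\<close>

definition nome :: complex where "nome = exp (2 * pi * \<i> * w2 / w1)"
text \<open>The multiplicative coordinate: translation by \<open>2 * w1\<close> leaves it fixed and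
  translation by \<open>2 * w2\<close> multiplies it by \<open>nome\<close>.\<close>

definition Ex :: "complex \<Rightarrow> complex" where "Ex s = exp (pi * \<i> * s / w1)"

text \<open>Up to a constant and an exponential factor this is the Weierstrass sigma function, here given by the
  Jacobi triple product.\<close>
definition theta :: "complex \<Rightarrow> complex" where
  "theta s = qprod nome (Ex s) * qprod nome (nome / Ex s)"

lemma nome_nonzero [simp]: "nome \<noteq> 0" by (simp add: nome_def)

lemma norm_nome: "norm nome < 1"
proof -
  have "Re (2 * pi * \<i> * w2 / w1) = - (2 * pi * Im (w2 / w1))"
  proof -
    have "2 * pi * \<i> * w2 / w1 = of_real (2 * pi) * (\<i> * (w2 / w1))" by simp
    moreover have "Re (of_real r * (\<i> * u)) = - (r * Im u)" for r u by simp
    ultimately show ?thesis by metis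
  qed
  also have "\<dots> < 0" using Im_ratio_pos by simp
  finally show ?thesis by (simp add: nome_def)
qed

lemma Ex_nonzero [simp]: "Ex s \<noteq> 0" by (simp add: Ex_def)

lemma Ex_0 [simp]: "Ex 0 = 1" by (simp add: Ex_def)

lemma Ex_add: "Ex (s + t) = Ex s * Ex t"
  by (simp add: Ex_def ring_distribs add_divide_distrib exp_add)

lemma Ex_diff: "Ex (s - t) = Ex s / Ex t"
  by (simp add: Ex_def ring_distribs diff_divide_distrib exp_diff)

lemma Ex_sum: "finite A \<Longrightarrow> Ex (\<Sum>i\<in>A. f i) = (\<Prod>i\<in>A. Ex (f i))"
  by (induction A rule: finite_induct) (auto simp: Ex_add)

lemma Ex_w1: "Ex (2 * w1) = 1"
proof -
  have "pi * \<i> * (2 * w1) / w1 = 2 * of_real pi * \<i>" using w1_nonzero by simp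
  thus ?thesis by (simp only: Ex_def exp_two_pi_i)
qed

lemma Ex_w2: "Ex (2 * w2) = nome"
  by (simp add: Ex_def nome_def mult_ac)

lemma Ex_w2_of_nat: "Ex (2 * of_nat n * w2) = nome ^ n"
proof (induction n)
  case (Suc n)
  have "2 * of_nat (Suc n) * w2 = 2 * w2 + 2 * of_nat n * w2" by (simp add: algebra_simps)
  thus ?case using Suc by (simp only: Ex_add Ex_w2) simp
qed simp

lemma Ex_eq_1_iff: "Ex s = 1 \<longleftrightarrow> (\<exists>a :: int. s = 2 * of_int a * w1)"
proof -
  have "Ex s = 1 \<longleftrightarrow> (\<exists>a :: int. pi * \<i> * s / w1 = of_int (2 * a) * pi * \<i>)"
    unfolding Ex_def using exp_eq[of "pi * \<i> * s / w1" 0] by simp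
  also have "\<dots> \<longleftrightarrow> (\<exists>a :: int. s = 2 * of_int a * w1)"
    using w1_nonzero by (intro ex_cong1) (auto simp: field_simps)
  finally show ?thesis .
qed

lemma theta_holomorphic: "theta holomorphic_on A"
proof -
  have E: "Ex holomorphic_on A" for A
    unfolding Ex_def using w1_nonzero by (intro holomorphic_intros) auto
  have "(qprod nome \<circ> Ex) holomorphic_on A"
    by (rule holomorphic_on_compose[OF E qprod_holomorphic[OF norm_nome]])
  moreover have "(qprod nome \<circ> (\<lambda>s. nome / Ex s)) holomorphic_on A"
    by (rule holomorphic_on_compose[OF _ qprod_holomorphic[OF norm_nome]])
       (intro holomorphic_on_divide E holomorphic_on_const, simp)
  ultimately show ?thesis
    unfolding theta_def[abs_def] using holomorphic_on_mult by (fastforce simp: o_def)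
qed

lemma theta_periodic: "theta (s + 2 * w1) = theta s"
  by (simp add: theta_def Ex_add Ex_w1)

text \<open>The shift replaces \<open>x = Ex s\<close> by \<open>nome * x\<close>. The first product
  loses its factor \<open>1 - x\<close>, the second gains \<open>1 - 1 / x\<close>, and the ratio of
  the new factor to the old one is \<open>- 1 / x\<close>.\<close>

lemma theta_quasiperiodic: "theta (s + 2 * w2) = - theta s / Ex s"
proof -
  define x where "x = Ex s"
  have x: "x \<noteq> 0" by (simp add: x_def)
  have A: "theta s = (1 - x) * qprod nome (nome * x) * qprod nome (nome / x)"
    unfolding theta_def x_def[symmetric] using qprod_rec[OF norm_nome, of x] by simp
  have "theta (s + 2 * w2) = qprod nome (nome * x) * qprod nome (1 / x)"
  proof -
    have "Ex (s + 2 * w2) = nome * x" by (simp add: Ex_add Ex_w2 x_def)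
    thus ?thesis unfolding theta_def by simp
  qed
  also have "qprod nome (1 / x) = (1 - 1 / x) * qprod nome (nome / x)"
    using qprod_rec[OF norm_nome, of "1 / x"] by simp
  finally have "theta (s + 2 * w2) = (1 - 1 / x) * qprod nome (nome * x) * qprod nome (nome / x)"
    by simp
  also have "1 - 1 / x = - (1 - x) / x" using x by (simp add: field_simps)
  finally have "theta (s + 2 * w2) = - (1 - x) / x * qprod nome (nome * x) * qprod nome (nome / x)" .
  moreover have "- (1 - x) / x * a * b = - ((1 - x) * a * b) / x" for a b
    using x by (simp add: field_simps)
  ultimately show ?thesis unfolding x_def[symmetric] A by metis
qed

lemma theta_eq_0_iff: "theta s = 0 \<longleftrightarrow> s \<in> L"
proof
  assume "theta s = 0"
  then consider n where "nome ^ n * Ex s = 1" | n where "nome ^ n * (nome / Ex s) = 1"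
    by (auto simp: theta_def qprod_eq_0_iff[OF norm_nome])
  thus "s \<in> L"
  proof cases
    case 1
    hence "Ex (2 * of_nat n * w2 + s) = 1" by (simp add: Ex_add Ex_w2_of_nat)
    then obtain a :: int where "2 * of_nat n * w2 + s = 2 * of_int a * w1"
      unfolding Ex_eq_1_iff by blast
    hence "s = 2 * of_int a * w1 + 2 * of_int (- int n) * w2" by (simp add: algebra_simps)
    thus ?thesis unfolding lattice_iff by blast
  next
    case 2
    hence "Ex s = nome ^ Suc n" by (simp add: field_simps)
    hence "Ex (s - 2 * of_nat (Suc n) * w2) = 1"
      unfolding Ex_diff Ex_w2_of_nat by simp
    then obtain a :: int where "s - 2 * of_nat (Suc n) * w2 = 2 * of_int a * w1"
      unfolding Ex_eq_1_iff by blast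
    hence "s = 2 * of_int a * w1 + 2 * of_int (int (Suc n)) * w2"
      by (simp only: of_int_of_nat_eq) (simp add: algebra_simps)
    thus ?thesis unfolding lattice_iff by blast
  qed
next
  assume "s \<in> L"
  then obtain a b :: int where s: "s = 2 * of_int a * w1 + 2 * of_int b * w2"
    unfolding lattice_iff by blast
  have Ea: "Ex (2 * of_int a * w1) = 1" unfolding Ex_eq_1_iff by blast
  show "theta s = 0"
  \<comment> \<open>The two products share the zeros between them: the second vanishes for
    \<open>b \<ge> 1\<close>, in its factor of index \<open>b - 1\<close>, and the first for
    \<open>b \<le> 0\<close>, in its factor of index \<open>- b\<close>.\<close>
  proof (cases "b \<ge> 1")
    case True
    define n where "n = nat (b - 1)"
    have "of_int b = (of_nat (Suc n) :: complex)" using True by (simp add: n_def of_nat_nat)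
    hence "Ex s = nome ^ Suc n"
      unfolding s Ex_add Ea by (simp only: Ex_w2_of_nat) simp
    hence "nome ^ n * (nome / Ex s) = 1" by simp
    thus ?thesis using qprod_eq_0_iff[OF norm_nome] by (auto simp: theta_def)
  next
    case False
    define n where "n = nat (- b)"
    have n: "of_nat n = - (of_int b :: complex)" using False by (simp add: n_def of_nat_nat)
    have "nome ^ n * Ex s = Ex (2 * of_nat n * w2 + s)" by (simp add: Ex_add Ex_w2_of_nat)
    also have "2 * of_nat n * w2 + s = 2 * of_int a * w1" unfolding s n by simp
    finally have "nome ^ n * Ex s = 1" using Ea by simp
    thus ?thesis using qprod_eq_0_iff[OF norm_nome] by (auto simp: theta_def)
  qed
qed

text \<open>The recursion isolates the vanishing factor \<open>1 - Ex s\<close>; the cofactor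
  \<open>U\<close> is nonzero at 0 because positive powers of \<open>nome\<close> have norm below 1.
  In the factorization below, the zero of \<open>theta (s - z i)\<close> at \<open>z i\<close> is
  translated back to this one.\<close>

lemma theta_simple_zero:
  obtains c where "c \<noteq> 0" "((\<lambda>s. theta s / s) \<longlongrightarrow> c) (at 0)"
proof -
  define U where "U = (\<lambda>s. qprod nome (nome * Ex s) * qprod nome (nome / Ex s))"
  have E: "(Ex has_field_derivative (pi * \<i> / w1)) (at 0)"
    unfolding Ex_def using w1_nonzero by (auto intro!: derivative_eq_intros)
  hence E0: "isCont Ex 0" by (rule DERIV_isCont)
  have q: "isCont (qprod nome) y" for y
    using holomorphic_on_imp_continuous_on[OF qprod_holomorphic[OF norm_nome, of UNIV]]
    by (simp add: continuous_on_eq_continuous_at)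
  have "isCont U 0" unfolding U_def
    by (intro continuous_intros isCont_o2[OF _ q] E0) auto
  hence U: "(U \<longlongrightarrow> U 0) (at 0)" by (simp add: isCont_def)
  have "((\<lambda>s. (Ex s - 1) / s) \<longlongrightarrow> pi * \<i> / w1) (at 0)"
    using E by (simp add: DERIV_def)
  hence "((\<lambda>s. - ((Ex s - 1) / s) * U s) \<longlongrightarrow> - (pi * \<i> / w1) * U 0) (at 0)"
    by (intro tendsto_mult[OF tendsto_minus U])
  moreover have "(\<lambda>s. - ((Ex s - 1) / s) * U s) = (\<lambda>s. theta s / s)"
  proof
    fix s
    have "theta s = (1 - Ex s) * U s"
      unfolding theta_def U_def using qprod_rec[OF norm_nome, of "Ex s"] by simp
    thus "- ((Ex s - 1) / s) * U s = theta s / s" by (simp add: minus_divide_left)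
  qed
  moreover have "U 0 \<noteq> 0"
  proof -
    have "nome ^ n * nome \<noteq> 1" for n
    proof
      assume "nome ^ n * nome = 1"
      hence "norm nome ^ Suc n = 1" by (metis norm_one norm_power power_Suc2)
      moreover have "norm nome ^ Suc n < 1" using norm_nome by (intro power_Suc_less_one) auto
      ultimately show False by simp
    qed
    thus ?thesis by (simp add: U_def qprod_eq_0_iff[OF norm_nome])
  qed
  ultimately show ?thesis using w1_nonzero by (intro that[of "- (pi * \<i> / w1) * U 0"]) simp_all
qed

section \<open>Elliptic functions with at most one simple pole\<close>

lemma lattice_coordinates_eq_0:
  assumes "2 * of_int a * w1 + 2 * of_int b * w2 = 0"
  shows "a = 0 \<and> b = 0"
proof -
  obtain c :: real where c: "c > 0"
    and bd: "\<And>a b :: int. norm (2 * of_int a * w1 + 2 * of_int b * w2) \<ge> c * (\<bar>a\<bar> + \<bar>b\<bar>)"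
    using lattice_norm_lower_bound by blast
  have "c * (\<bar>a\<bar> + \<bar>b\<bar>) \<le> 0" using bd[of a b] assms by simp
  hence "real_of_int (\<bar>a\<bar> + \<bar>b\<bar>) \<le> 0" using c by (simp only: mult_le_0_iff) auto
  thus ?thesis by linarith
qed

lemma half_period_not_in_lattice:
  assumes "odd a \<or> odd b"
  shows "of_int a * w1 + of_int b * w2 \<notin> L"
proof
  assume "of_int a * w1 + of_int b * w2 \<in> L"
  then obtain c d :: int where "of_int a * w1 + of_int b * w2 = 2 * of_int c * w1 + 2 * of_int d * w2"
    unfolding lattice_iff by blast
  hence "2 * (of_int a * w1 + of_int b * w2) = 2 * (2 * of_int c * w1 + 2 * of_int d * w2)"
    by simp
  hence "2 * of_int (a - 2 * c) * w1 + 2 * of_int (b - 2 * d) * w2 = 0"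
    by (simp add: algebra_simps)
  hence "a - 2 * c = 0 \<and> b - 2 * d = 0" by (rule lattice_coordinates_eq_0)
  thus False using assms by auto
qed

lemma lattice_periodic:
  fixes f :: "complex \<Rightarrow> 'a"
  assumes "\<And>s. f (s + 2 * w1) = f s" "\<And>s. f (s + 2 * w2) = f s" "w \<in> L"
  shows "f (s + w) = f s"
proof -
  have shift: "f (s + of_int a * c) = f s" if c: "\<And>s. f (s + c) = f s" for s c and a :: int
  proof (induction a rule: int_induct[where k = 0])
    case (step1 i)
    have "s + of_int (i + 1) * c = (s + of_int i * c) + c" by (simp add: algebra_simps)
    thus ?case using step1 c by metis
  next
    case (step2 i)
    have "(s + of_int (i - 1) * c) + c = s + of_int i * c" by (simp add: algebra_simps)
    thus ?case using step2 c by metis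
  qed simp
  obtain a b :: int where "w = 2 * of_int a * w1 + 2 * of_int b * w2"
    using assms(3) unfolding lattice_iff by blast
  hence "s + w = (s + of_int a * (2 * w1)) + of_int b * (2 * w2)" by (simp add: algebra_simps)
  thus ?thesis by (simp only: shift[OF assms(1)] shift[OF assms(2)])
qed

lemma fundamental_parallelogram:
  obtains K where "compact K" "\<And>s. \<exists>w\<in>L. s + w \<in> K"
proof -
  define P where "P = (\<lambda>x :: real \<times> real. 2 * of_real (fst x) * w1 + 2 * of_real (snd x) * w2)"
  define K where "K = P ` (cbox (0, 0) (1, 1))"
  have "continuous_on A P" for A unfolding P_def by (intro continuous_intros)
  hence "compact K" unfolding K_def by (intro compact_continuous_image compact_cbox)
  moreover have "\<exists>w\<in>L. s + w \<in> K" for s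
  proof -
    define \<tau> where "\<tau> = w2 / w1"
    define u where "u = s / (2 * w1)"
    define y where "y = Im u / Im \<tau>"
    define x where "x = Re u - y * Re \<tau>"
    have \<tau>: "Im \<tau> > 0" using Im_ratio_pos by (simp add: \<tau>_def)
    have "u = of_real x + of_real y * \<tau>"
      by (rule complex_eqI) (use \<tau> in \<open>simp_all add: x_def y_def\<close>)
    hence "w1 * u = of_real x * w1 + of_real y * w2"
      using w1_nonzero by (simp add: \<tau>_def field_simps)
    hence "2 * (w1 * u) = 2 * (of_real x * w1 + of_real y * w2)" by simp
    hence "2 * w1 * u = 2 * of_real x * w1 + 2 * of_real y * w2" by (simp add: algebra_simps)
    hence s: "s = P (x, y)" using w1_nonzero by (simp add: u_def P_def)
    define w where "w = 2 * of_int (- \<lfloor>x\<rfloor>) * w1 + 2 * of_int (- \<lfloor>y\<rfloor>) * w2"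
    have "w \<in> L" unfolding w_def lattice_iff by blast
    moreover have "s + w = P (frac x, frac y)"
      unfolding s w_def P_def by (simp add: frac_def algebra_simps)
    moreover have "(frac x, frac y) \<in> cbox (0, 0) (1, 1)"
      by (simp add: cbox_Pair_eq frac_ge_0 less_imp_le[OF frac_lt_1])
    ultimately show ?thesis unfolding K_def by blast
  qed
  ultimately show ?thesis using that by blast
qed

text \<open>All singularities are removable, so \<open>remove_sings f\<close> is entire, and by
  periodicity it takes all its values on a compact set. The conclusion is restricted to points of
  continuity because the value of \<open>f\<close> at a removable singularity is arbitrary.\<close>

lemma elliptic_liouville:
  assumes per: "\<And>s. f (s + 2 * w1) = f s" "\<And>s. f (s + 2 * w2) = f s"
    and iso: "\<And>p. isolated_singularity_at f p"
    and lim: "\<And>p. \<exists>c. (f \<longlongrightarrow> c) (at p)"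
  obtains c where "\<And>p. isCont f p \<Longrightarrow> f p = c"
proof -
  define F where "F = remove_sings f"
  have "F analytic_on {p}" for p
    unfolding F_def using iso[of p] lim[of p] by (auto intro: remove_sings_analytic_at)
  hence "F analytic_on UNIV" by (subst analytic_on_analytic_at) blast
  hence hol: "F holomorphic_on UNIV" by (rule analytic_imp_holomorphic)
  have F_per: "F (s + w) = F s" if "w \<in> L" for s w
    unfolding F_def by (rule lattice_periodic[OF _ _ that]) (rule remove_sings_periodic, rule per)+
  obtain K where K: "compact K" "\<And>s. \<exists>w\<in>L. s + w \<in> K"
    using fundamental_parallelogram by blast
  have "range F \<subseteq> F ` K"
  proof
    fix y assume "y \<in> range F"
    then obtain s where s: "y = F s" by blast
    obtain w where "w \<in> L" "s + w \<in> K" using K(2) by blast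
    thus "y \<in> F ` K" using F_per[of w s] s by (metis imageI)
  qed
  moreover have "compact (F ` K)"
    using holomorphic_on_imp_continuous_on[OF hol] K(1)
    by (meson compact_continuous_image continuous_on_subset subset_UNIV)
  ultimately have "bounded (range F)" using bounded_subset compact_imp_bounded by blast
  with hol have "F constant_on UNIV" by (rule Liouville_theorem)
  then obtain c where c: "\<And>s. F s = c" by (auto simp: constant_on_def)
  show ?thesis
  proof (rule that[of c])
    fix p assume "isCont f p"
    hence "F p = f p" unfolding F_def by (intro remove_sings_eqI) (simp add: isCont_def)
    thus "f p = c" using c by simp
  qed
qed

lemma isolated_singularity_in_complement_lattice:
  assumes "f holomorphic_on - L"
  shows "isolated_singularity_at f p"
  unfolding isolated_singularity_at_altdef
proof -
  have "f analytic_on - L" using assms open_complement_lattice by (simp add: analytic_on_open)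
  hence "f analytic_on {z}" if "z \<notin> L" for z
    by (rule analytic_on_subset) (use that in simp)
  thus "\<forall>\<^sub>F z in at p. f analytic_on {z}"
    using eventually_not_in_lattice[of 0 p] by (elim eventually_mono) simp
qed

lemma isCont_complement_lattice:
  assumes "f holomorphic_on - L" "p \<notin> L"
  shows "isCont f p"
  using assms open_complement_lattice
  by (meson ComplI continuous_on_eq_continuous_at holomorphic_on_imp_continuous_on)

text \<open>By Riemann's theorem the limit 0 makes the singularity at the origin removable, and
  periodicity carries this to every lattice point. It is the case of residue 0, which the even part
  of a function with a simple pole falls under.\<close>

lemma elliptic_weak_pole_constant:
  assumes per: "\<And>s. f (s + 2 * w1) = f s" "\<And>s. f (s + 2 * w2) = f s"
    and hol: "f holomorphic_on - L"
    and lim: "((\<lambda>s. s * f s) \<longlongrightarrow> 0) (at 0)"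
  obtains c where "\<And>s. s \<notin> L \<Longrightarrow> f s = c"
proof -
  obtain R :: real where R: "R > 0" "ball 0 R \<inter> L = {0}"
    by (rule wp_pole_expansion)
  have "f holomorphic_on (ball 0 R - {0})"
    by (rule holomorphic_on_subset[OF hol]) (use R(2) in blast)
  moreover have "0 \<in> interior (ball (0 :: complex) R)" using R by simp
  moreover have "((\<lambda>z. (z - 0) * f z) \<longlongrightarrow> 0) (at 0)" using lim by simp
  ultimately have "\<exists>g. g holomorphic_on ball 0 R \<and> (\<forall>z\<in>ball 0 R - {0}. g z = f z)"
    by (rule holomorphic_on_extend_lim[THEN iffD2])
  then obtain g where g: "g holomorphic_on ball 0 R" and eq: "\<And>z. z \<in> ball 0 R - {0} \<Longrightarrow> g z = f z"
    by blast
  have "isCont g 0" using g R(1)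
    by (intro continuous_on_interior[OF holomorphic_on_imp_continuous_on]) auto
  hence "(g \<longlongrightarrow> g 0) (at 0)" by (simp add: isCont_def)
  moreover have "eventually (\<lambda>s. g s = f s) (at 0)"
  proof -
    have "eventually (\<lambda>s. s \<in> ball 0 R - {0}) (at (0::complex))"
      using R(1) by (intro eventually_at_in_open) auto
    thus ?thesis by eventually_elim (rule eq)
  qed
  ultimately have lim0: "(f \<longlongrightarrow> g 0) (at 0)" by (rule Lim_transform_eventually)
  have lims: "\<exists>c. (f \<longlongrightarrow> c) (at p)" for p
  proof (cases "p \<in> L")
    case True
    have "(f \<longlongrightarrow> g 0) (at (0 + p))"
      by (rule tendsto_shift_periodic[OF lattice_periodic[OF per True] lim0])
    thus ?thesis by auto
  next
    case False
    thus ?thesis using isCont_complement_lattice[OF hol, of p] unfolding isCont_def by blast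
  qed
  obtain c where c: "\<And>p. isCont f p \<Longrightarrow> f p = c"
    by (rule elliptic_liouville[OF per isolated_singularity_in_complement_lattice[OF hol] lims]) blast
  show ?thesis by (rule that[of c]) (intro c isCont_complement_lattice[OF hol])
qed

lemma holomorphic_on_mirror:
  assumes "f holomorphic_on - L"
  shows "(\<lambda>s. f (- s)) holomorphic_on - L"
proof -
  have "(f \<circ> uminus) holomorphic_on - L"
    by (rule holomorphic_on_compose_gen[OF _ assms]) (auto intro: holomorphic_intros)
  thus ?thesis by (simp add: o_def)
qed

text \<open>An elliptic function cannot have a single simple pole. Subtracting the even part, which is
  constant, one may assume that \<open>f\<close> is odd, so that it vanishes at the half periods. Then
  \<open>f s * f (s + w1)\<close> has no poles and vanishes at \<open>w2\<close>.\<close>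
lemma elliptic_simple_pole_constant:
  assumes per: "\<And>s. f (s + 2 * w1) = f s" "\<And>s. f (s + 2 * w2) = f s"
    and hol: "f holomorphic_on - L"
    and lim: "((\<lambda>s. s * f s) \<longlongrightarrow> r) (at 0)"
  obtains c where "\<And>s. s \<notin> L \<Longrightarrow> f s = c"
proof -
  have perL: "f (s + w) = f s" if "w \<in> L" for s w by (rule lattice_periodic[OF per that])
  have per_minus: "f (- (s + w)) = f (- s)" if "w \<in> L" for s w
    using perL[of "- w" "- s"] that by simp
  note hol' = holomorphic_on_mirror[OF hol]
  have lim': "((\<lambda>s. s * f (- s)) \<longlongrightarrow> - r) (at 0)"
  proof -
    have "filterlim uminus (at 0) (at (0::complex))"
      by (rule filterlim_atI) (auto intro!: tendsto_eq_intros simp: eventually_at_filter)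
    from filterlim_compose[OF lim this] have "((\<lambda>s. - s * f (- s)) \<longlongrightarrow> r) (at 0)" .
    from tendsto_minus[OF this] show ?thesis by simp
  qed
  \<comment> \<open>The residues \<open>r\<close> of \<open>f s\<close> and \<open>- r\<close> of
    \<open>f (- s)\<close> cancel in the sum.\<close>
  obtain c where c: "\<And>s. s \<notin> L \<Longrightarrow> f s + f (- s) = c"
  proof (rule elliptic_weak_pole_constant)
    show "(\<lambda>s. f s + f (- s)) holomorphic_on - L" by (intro holomorphic_intros hol hol')
    show "((\<lambda>s. s * (f s + f (- s))) \<longlongrightarrow> 0) (at 0)"
      using tendsto_add[OF lim lim'] by (simp add: ring_distribs)
  qed (auto simp: perL per_minus simp del: minus_add_distrib)
  define g where "g = (\<lambda>s. f s - f (- s))"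
  have g_hol: "g holomorphic_on - L" unfolding g_def by (intro holomorphic_intros hol hol')
  have g_per: "g (s + w) = g s" if "w \<in> L" for s w
    unfolding g_def using perL[OF that] per_minus[OF that] by simp
  have g_minus: "g (- s) = - g s" for s by (simp add: g_def)
  \<comment> \<open>If \<open>2 * p\<close> is a period, then \<open>p\<close> and
    \<open>- p\<close> are congruent, and an odd function has to vanish there.\<close>
  have g_half: "g p = 0" if "2 * p \<in> L" for p
  proof -
    have "g (- p + 2 * p) = g (- p)" by (rule g_per[OF that])
    hence "g p = - g p" by (simp add: g_minus)
    thus ?thesis by simp
  qed
  have g_lim: "((\<lambda>s. s * g s) \<longlongrightarrow> r - (- r)) (at 0)"
    using tendsto_diff[OF lim lim'] by (simp add: g_def ring_distribs)
  have half: "w1 \<notin> L" "w2 \<notin> L" "w1 + w2 \<notin> L"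
    using half_period_not_in_lattice[of 1 0] half_period_not_in_lattice[of 0 1]
      half_period_not_in_lattice[of 1 1] by auto
  define h where "h = (\<lambda>s. g s * g (s + w1))"
  have "2 * w1 \<in> L" "2 * w2 \<in> L" by auto
  have h_per: "h (s + w) = h s" if "w \<in> L" for s w
  proof -
    have "g (s + w + w1) = g (s + w1)" using g_per[OF that, of "s + w1"] by (simp add: add_ac)
    thus ?thesis using g_per[OF that, of s] by (simp add: h_def)
  qed
  \<comment> \<open>Translation by \<open>w1\<close> exchanges the two factors of \<open>h\<close>.
    This extra period later carries the limit at lattice points over to the points \<open>p\<close>
    with \<open>p + w1 \<in> L\<close>.\<close>
  have h_half: "h (s + w1) = h s" for s
  proof -
    have "g (s + w1 + w1) = g s" using g_per[OF \<open>2 * w1 \<in> L\<close>, of s] by (simp add: algebra_simps)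
    thus ?thesis by (simp add: h_def)
  qed
  have h_ana: "h analytic_on {s}" if "s \<notin> L" "s + w1 \<notin> L" for s
  proof -
    have ana: "g analytic_on - L" using g_hol open_complement_lattice by (simp add: analytic_on_open)
    have "g analytic_on {s}" by (rule analytic_on_subset[OF ana]) (use that in auto)
    moreover have "(g \<circ> (\<lambda>s. s + w1)) analytic_on {s}"
      by (rule analytic_on_compose_gen[OF _ ana]) (use that in \<open>auto intro: analytic_intros\<close>)
    ultimately show ?thesis unfolding h_def by (auto simp: o_def intro: analytic_on_mult)
  qed
  have h_iso: "isolated_singularity_at h p" for p
    unfolding isolated_singularity_at_altdef
    using eventually_not_in_lattice[of 0 p] eventually_not_in_lattice[of "- w1" p]
    by eventually_elim (auto intro: h_ana)
  \<comment> \<open>Near 0 the simple pole of \<open>g s\<close> is compensated by the zero of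
    \<open>g (s + w1)\<close> at the half period \<open>w1\<close>.\<close>
  have "\<exists>c. (h \<longlongrightarrow> c) (at 0)"
  proof -
    have "(g has_field_derivative deriv g w1) (at w1)"
      using g_hol open_complement_lattice half by (intro holomorphic_derivI) auto
    hence "((\<lambda>s. g (w1 + s) / s) \<longlongrightarrow> deriv g w1) (at 0)"
      using g_half[of w1] by (simp add: DERIV_def)
    hence "((\<lambda>s. (s * g s) * (g (w1 + s) / s)) \<longlongrightarrow> (r - (- r)) * deriv g w1) (at 0)"
      by (rule tendsto_mult[OF g_lim])
    moreover have "eventually (\<lambda>s. (s * g s) * (g (w1 + s) / s) = h s) (at (0 :: complex))"
      by (simp add: eventually_at_filter h_def add.commute)
    ultimately show ?thesis using Lim_transform_eventually by blast
  qed
  then obtain c0 where c0: "(h \<longlongrightarrow> c0) (at 0)" by blast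
  have limL: "(h \<longlongrightarrow> c0) (at p)" if "p \<in> L" for p
    using tendsto_shift_periodic[OF h_per[OF that] c0] by simp
  have h_lim: "\<exists>c. (h \<longlongrightarrow> c) (at p)" for p
  proof (cases "p \<in> L \<or> p + w1 \<in> L")
    case False
    hence "isCont h p" by (intro analytic_at_imp_isCont h_ana) auto
    thus ?thesis unfolding isCont_def by blast
  next
    case True
    have "(h \<longlongrightarrow> c0) (at p)" if "p + w1 \<in> L"
    proof -
      have "h (s - w1) = h s" for s using h_half[of "s - w1"] by simp
      hence "(h \<longlongrightarrow> c0) (at (p + w1 + (- w1)))"
        by (intro tendsto_shift_periodic limL that) simp
      thus ?thesis by simp
    qed
    thus ?thesis using True limL by blast
  qed
  obtain c1 where c1: "\<And>p. isCont h p \<Longrightarrow> h p = c1"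
    by (rule elliptic_liouville[OF h_per[OF \<open>2 * w1 \<in> L\<close>] h_per[OF \<open>2 * w2 \<in> L\<close>] h_iso h_lim]) blast
  \<comment> \<open>Both \<open>w2\<close> and \<open>w1 + w2\<close> are off the lattice, so the
    value of \<open>h\<close> at \<open>w2\<close> is genuine; it is 0 since \<open>g\<close>
    vanishes at \<open>w2\<close>, and this fixes the constant.\<close>
  have "isCont h w2" using half by (intro analytic_at_imp_isCont h_ana) (auto simp: add.commute)
  hence "c1 = 0" using c1[of w2] g_half[of w2] by (simp add: h_def)
  hence h0: "g s * g (s + w1) = 0" if "s \<notin> L" "s + w1 \<notin> L" for s
    using c1[OF analytic_at_imp_isCont[OF h_ana[OF that]]] by (simp add: h_def)
  \<comment> \<open>If \<open>g\<close> were nonzero somewhere, it would be nonzero on the open set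
    \<open>U\<close>. The vanishing product then forces \<open>g = 0\<close> on the translate of
    \<open>U\<close> by \<open>w1\<close>, and the identity theorem on the connected complement of
    the lattice gives \<open>g = 0\<close> throughout.\<close>
  have g0: "g s = 0" if "s \<notin> L" for s
  proof (rule ccontr)
    assume gs: "g s \<noteq> 0"
    define U where "U = {t \<in> - L. g t \<noteq> 0}"
    have "open U"
    proof -
      have "open (- L \<inter> g -` (- {0}))"
        using holomorphic_on_imp_continuous_on[OF g_hol] open_complement_lattice
        by (intro continuous_open_preimage) auto
      moreover have "U = - L \<inter> g -` (- {0})" by (auto simp: U_def)
      ultimately show ?thesis by simp
    qed
    define V where "V = (\<lambda>t. w1 + t) ` U \<inter> - L"
    have "open V" unfolding V_def
      using \<open>open U\<close> open_complement_lattice by (intro open_Int open_translation)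
    have "V \<noteq> {}"
    proof -
      have "s \<in> U" using gs that by (simp add: U_def)
      hence "eventually (\<lambda>t. t \<in> U) (at s)"
        using \<open>open U\<close> eventually_at_topological by blast
      hence "eventually (\<lambda>t. t \<in> U \<and> t - (- w1) \<notin> L) (at s)"
        using eventually_not_in_lattice[of "- w1" s] by (rule eventually_conj)
      then obtain t where "t \<in> U" "t + w1 \<notin> L"
        using eventually_happens'[OF at_neq_bot[of s]] by (auto simp: algebra_simps)
      hence "w1 + t \<in> V" unfolding V_def by (auto simp: add.commute)
      thus ?thesis by blast
    qed
    have V0: "g v = 0" if "v \<in> V" for v
    proof -
      obtain t where t: "t \<in> U" "v = w1 + t" "w1 + t \<notin> L" using \<open>v \<in> V\<close> by (auto simp: V_def)
      have v: "t + w1 = v" using t(2) by simp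
      have "v \<notin> L" using t(2,3) by simp
      hence "g t * g v = 0" using h0[of t, unfolded v] t(1) by (simp add: U_def)
      moreover have "g t \<noteq> 0" using t(1) by (simp add: U_def)
      ultimately show ?thesis by simp
    qed
    have "g s = 0"
      by (rule analytic_continuation_open[OF \<open>open V\<close> open_complement_lattice \<open>V \<noteq> {}\<close>
            connected_complement_lattice _ g_hol holomorphic_on_const V0])
         (use that in \<open>simp_all add: V_def\<close>)
    thus False using gs by simp
  qed
  show ?thesis
  proof (rule that[of "c / 2"])
    fix s assume "s \<notin> L"
    have "f s - f (- s) = 0" using g0[OF \<open>s \<notin> L\<close>] by (simp add: g_def)
    hence "f (- s) = f s" by (simp only: right_minus_eq)
    hence "2 * f s = c" using c[OF \<open>s \<notin> L\<close>] by (simp only: mult_2)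
    thus "f s = c / 2" by (metis nonzero_mult_div_cancel_left zero_neq_numeral)
  qed
qed

section \<open>Factorization by theta functions\<close>

lemma isCont_theta: "isCont theta s"
  using holomorphic_on_imp_continuous_on[OF theta_holomorphic[of UNIV]]
  by (simp add: continuous_on_eq_continuous_at)

lemma isCont_prod_theta: "isCont (\<lambda>s. \<Prod>i\<in>A. theta (s - z i)) s"
  by (intro continuous_prod isCont_o2[OF _ isCont_theta] continuous_intros)

lemma prod_theta_eq_0_iff:
  "finite A \<Longrightarrow> (\<Prod>i\<in>A. theta (s - z i)) = 0 \<longleftrightarrow> (\<exists>i\<in>A. s - z i \<in> L)"
  by (simp add: theta_eq_0_iff)

lemma prod_theta_periodic: "(\<Prod>i\<in>A. theta (s + 2 * w1 - z i)) = (\<Prod>i\<in>A. theta (s - z i))"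
proof (rule prod.cong[OF refl])
  fix i
  have "s + 2 * w1 - z i = (s - z i) + 2 * w1" by simp
  thus "theta (s + 2 * w1 - z i) = theta (s - z i)" by (simp only: theta_periodic)
qed

text \<open>Each factor contributes \<open>- 1 / Ex s\<close> times \<open>Ex (z i)\<close>. The
  constants multiply to \<open>Ex 0 = 1\<close> when the points sum to 0, so the product transforms
  exactly like a power of \<open>theta s\<close>; this is where the sum condition of Abel's theorem
  enters.\<close>

lemma prod_theta_quasiperiodic:
  assumes "finite A" "(\<Sum>i\<in>A. z i) = 0"
  shows "(\<Prod>i\<in>A. theta (s + 2 * w2 - z i)) = (- 1 / Ex s) ^ card A * (\<Prod>i\<in>A. theta (s - z i))"
proof -
  have "theta (s + 2 * w2 - z i) = (- 1 / Ex s) * Ex (z i) * theta (s - z i)" for i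
  proof -
    have "s + 2 * w2 - z i = (s - z i) + 2 * w2" by simp
    hence "theta (s + 2 * w2 - z i) = - theta (s - z i) / Ex (s - z i)"
      by (simp only: theta_quasiperiodic)
    thus ?thesis by (simp add: Ex_diff)
  qed
  hence "(\<Prod>i\<in>A. theta (s + 2 * w2 - z i))
      = (\<Prod>i\<in>A. (- 1 / Ex s)) * (\<Prod>i\<in>A. Ex (z i)) * (\<Prod>i\<in>A. theta (s - z i))"
    by (simp only: prod.distrib)
  moreover have "(\<Prod>i\<in>A. Ex (z i)) = 1"
    using Ex_sum[OF assms(1), of z] assms(2) by simp
  ultimately show ?thesis by (simp only: prod_constant mult_1_right)
qed

text \<open>Only the first \<open>n\<close> points are assumed to be zeros of \<open>f\<close>. At
  \<open>z n\<close> the theta quotient might have a simple pole, and the exclusion of a single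
  simple pole makes the quotient constant; the vanishing of \<open>f\<close> at \<open>z n\<close>
  is thus a consequence. The conclusion is multiplied out so that it also holds at the zeros of the
  denominator.\<close>

lemma elliptic_theta_factorization:
  assumes per: "\<And>s. f (s + 2 * w1) = f s" "\<And>s. f (s + 2 * w2) = f s"
    and hol: "f holomorphic_on - L"
    and lim0: "((\<lambda>s. s ^ Suc n * f s) \<longlongrightarrow> c) (at 0)"
    and sum0: "(\<Sum>i\<le>n. z i) = 0"
    and dist: "\<And>i j. i \<le> n \<Longrightarrow> j \<le> n \<Longrightarrow> i \<noteq> j \<Longrightarrow> z i - z j \<notin> L"
    and notin: "\<And>i. i \<le> n \<Longrightarrow> z i \<notin> L"
    and zero: "\<And>i. i < n \<Longrightarrow> f (z i) = 0"
  obtains K where "\<And>s. s \<notin> L \<Longrightarrow> f s * theta s ^ Suc n = K * (\<Prod>i\<le>n. theta (s - z i))"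
proof -
  define D where "D = (\<lambda>s. \<Prod>i\<le>n. theta (s - z i))"
  define g where "g = (\<lambda>s. f s * theta s ^ Suc n / D s)"
  define p where "p = z n"
  have D_cont: "isCont D s" for s unfolding D_def by (rule isCont_prod_theta)
  have D_0: "D s = 0 \<longleftrightarrow> (\<exists>i\<le>n. s - z i \<in> L)" for s
    unfolding D_def by (subst prod_theta_eq_0_iff) auto
  obtain ct where ct: "ct \<noteq> 0" "((\<lambda>s. theta s / s) \<longlongrightarrow> ct) (at 0)"
    using theta_simple_zero by blast

  have g_per1: "g (s + 2 * w1) = g s" for s
    unfolding g_def D_def by (simp only: per prod_theta_periodic theta_periodic)
  have g_per2: "g (s + 2 * w2) = g s" for s
  proof -
    have "D (s + 2 * w2) = (- 1 / Ex s) ^ Suc n * D s"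
      unfolding D_def using prod_theta_quasiperiodic[of "{..n}" z s] sum0 by simp
    moreover have "theta (s + 2 * w2) ^ Suc n = (- 1 / Ex s) ^ Suc n * theta s ^ Suc n"
    proof -
      have "theta (s + 2 * w2) = (- 1 / Ex s) * theta s" by (simp add: theta_quasiperiodic)
      thus ?thesis by (simp only: power_mult_distrib)
    qed
    moreover have "(- 1 / Ex s) ^ Suc n \<noteq> 0" by simp
    ultimately show ?thesis
      unfolding g_def per by (simp only: mult.left_commute[of "f s"]) (rule mult_divide_mult_cancel_left)
  qed
  have g_perL: "g (s + w) = g s" if "w \<in> L" for s w
    by (rule lattice_periodic[of g, OF g_per1 g_per2 that])

  have g_ana: "g analytic_on {s}" if "s \<notin> L" "D s \<noteq> 0" for s
  proof -
    have "f analytic_on {s}"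
      by (rule analytic_on_subset[of _ "- L"])
         (use hol open_complement_lattice that in \<open>simp_all add: analytic_on_open\<close>)
    moreover have theta_ana: "theta analytic_on B" for B
      using theta_holomorphic[of UNIV] by (metis analytic_on_holomorphic open_UNIV subset_UNIV)
    moreover have "(\<lambda>s. theta (s - z i)) analytic_on {s}" for i
    proof -
      have "(theta \<circ> (\<lambda>s. s - z i)) analytic_on {s}"
        by (rule analytic_on_compose[OF _ theta_ana]) (intro analytic_intros)
      thus ?thesis by (simp add: o_def)
    qed
    ultimately show ?thesis
      unfolding g_def using that(2) unfolding D_def
      by (intro analytic_on_divide analytic_on_mult analytic_on_power analytic_on_prod) auto
  qed
  have ev_good: "eventually (\<lambda>s. s \<notin> L \<and> D s \<noteq> 0) (at q)" for q
  proof -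
    have "eventually (\<lambda>s. \<forall>i\<in>{..n}. s - z i \<notin> L) (at q)"
      by (intro eventually_ball_finite ballI eventually_not_in_lattice) simp
    moreover have "eventually (\<lambda>s. s - 0 \<notin> L) (at q)" by (rule eventually_not_in_lattice)
    ultimately show ?thesis by eventually_elim (simp add: D_0)
  qed
  have g_iso: "isolated_singularity_at g q" for q
    unfolding isolated_singularity_at_altdef
    using ev_good[of q] by eventually_elim (simp add: g_ana)

  have lim_0: "\<exists>b. (g \<longlongrightarrow> b) (at 0)"
  proof -
    have "D 0 \<noteq> 0" using notin by (simp add: D_0)
    moreover have "(D \<longlongrightarrow> D 0) (at 0)" using D_cont by (simp add: isCont_def)
    ultimately have "((\<lambda>s. (s ^ Suc n * f s) * (theta s / s) ^ Suc n / D s) \<longlongrightarrow> c * ct ^ Suc n / D 0) (at 0)"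
      by (intro tendsto_divide tendsto_mult tendsto_power lim0 ct(2))
    moreover have "eventually (\<lambda>s. (s ^ Suc n * f s) * (theta s / s) ^ Suc n / D s = g s) (at 0)"
    proof -
      have "eventually (\<lambda>s. s \<noteq> 0) (at (0::complex))" by (simp add: eventually_at_filter)
      thus ?thesis by eventually_elim (simp add: g_def power_divide)
    qed
    ultimately show ?thesis using Lim_transform_eventually by blast
  qed

  \<comment> \<open>\<open>g s\<close> equals \<open>f s * Q j s / (s - z j)\<close>, and
    \<open>Q j\<close> has a limit at \<open>z j\<close> because incongruence of the points makes
    the zero of \<open>D\<close> there simple. For \<open>j < n\<close> the zero of \<open>f\<close>
    absorbs the remaining denominator; for \<open>j = n\<close> a possible simple pole at
    \<open>p\<close> is left.\<close>
  define Q where "Q = (\<lambda>j s. (s - z j) * theta s ^ Suc n / D s)"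
  have Q_lim: "\<exists>b. (Q j \<longlongrightarrow> b) (at (z j))" if j: "j \<le> n" for j
  proof -
    define Dj where "Dj = (\<lambda>s. \<Prod>i\<in>{..n} - {j}. theta (s - z i))"
    have D_eq: "D s = theta (s - z j) * Dj s" for s
      unfolding D_def Dj_def using j by (intro prod.remove) auto
    have "Dj (z j) \<noteq> 0"
      unfolding Dj_def using dist j by (subst prod_theta_eq_0_iff) auto
    moreover have "(Dj \<longlongrightarrow> Dj (z j)) (at (z j))"
      using isCont_prod_theta[where A = "{..n} - {j}" and z = z and s = "z j"] unfolding Dj_def isCont_def .
    moreover have "(theta \<longlongrightarrow> theta (z j)) (at (z j))" using isCont_theta by (simp add: isCont_def)
    moreover have "((\<lambda>s. theta (s - z j) / (s - z j)) \<longlongrightarrow> ct) (at (z j))"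
      unfolding filterlim_at_to_0[of _ _ "z j"] using ct(2) by simp
    ultimately have "((\<lambda>s. theta s ^ Suc n / ((theta (s - z j) / (s - z j)) * Dj s))
        \<longlongrightarrow> theta (z j) ^ Suc n / (ct * Dj (z j))) (at (z j))"
      using ct(1) by (intro tendsto_divide tendsto_mult tendsto_power) simp_all
    moreover have "(\<lambda>s. theta s ^ Suc n / ((theta (s - z j) / (s - z j)) * Dj s)) = Q j"
      by (simp add: Q_def D_eq fun_eq_iff mult.commute)
    ultimately show ?thesis by auto
  qed
  have lim_zero: "\<exists>b. (g \<longlongrightarrow> b) (at (z j))" if j: "j < n" for j
  proof -
    obtain b where b: "(Q j \<longlongrightarrow> b) (at (z j))" using Q_lim[of j] j by auto
    have "(f has_field_derivative deriv f (z j)) (at (z j))"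
      using hol open_complement_lattice notin[of j] j by (intro holomorphic_derivI) auto
    hence "((\<lambda>s. f s / (s - z j)) \<longlongrightarrow> deriv f (z j)) (at (z j))"
      using zero[OF j] by (simp add: has_field_derivative_iff)
    hence "((\<lambda>s. f s / (s - z j) * Q j s) \<longlongrightarrow> deriv f (z j) * b) (at (z j))"
      using b by (rule tendsto_mult)
    moreover have "eventually (\<lambda>s. f s / (s - z j) * Q j s = g s) (at (z j))"
    proof -
      have "eventually (\<lambda>s. s \<noteq> z j) (at (z j))" by (simp add: eventually_at_filter)
      thus ?thesis by eventually_elim (simp add: g_def Q_def)
    qed
    ultimately show ?thesis using Lim_transform_eventually by blast
  qed
  obtain r where r: "((\<lambda>s. (s - p) * g s) \<longlongrightarrow> r) (at p)"
  proof -
    obtain b where b: "(Q n \<longlongrightarrow> b) (at p)" using Q_lim[of n] by (auto simp: p_def)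
    have "isCont f p" using notin[of n] by (intro isCont_complement_lattice[OF hol]) (simp add: p_def)
    hence "(f \<longlongrightarrow> f p) (at p)" by (simp add: isCont_def)
    hence "((\<lambda>s. f s * Q n s) \<longlongrightarrow> f p * b) (at p)" using b by (rule tendsto_mult)
    moreover have "(\<lambda>s. f s * Q n s) = (\<lambda>s. (s - p) * g s)"
      by (simp add: fun_eq_iff g_def Q_def p_def)
    ultimately show ?thesis using that by simp
  qed
  have lim_q: "\<exists>b. (g \<longlongrightarrow> b) (at q)" if qp: "q - p \<notin> L" for q
  proof -
    have shift: "\<exists>b. (g \<longlongrightarrow> b) (at q)" if ex: "\<exists>b. (g \<longlongrightarrow> b) (at q')" and w: "q - q' \<in> L" for q'
    proof -
      obtain b where "(g \<longlongrightarrow> b) (at q')" using ex by blast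
      hence "(g \<longlongrightarrow> b) (at (q' + (q - q')))" by (intro tendsto_shift_periodic g_perL[OF w])
      thus ?thesis by auto
    qed
    consider "q \<in> L" | i where "i < n" "q - z i \<in> L" | "q \<notin> L" "D q \<noteq> 0"
      using qp D_0[of q] unfolding p_def by (metis le_neq_implies_less)
    thus ?thesis
    proof cases
      case 1
      show ?thesis by (rule shift[OF lim_0]) (use 1 in simp)
    next
      case 2
      show ?thesis by (rule shift[OF lim_zero[OF 2(1)] 2(2)])
    next
      case 3
      hence "isCont g q" by (intro analytic_at_imp_isCont g_ana)
      thus ?thesis unfolding isCont_def by blast
    qed
  qed

  \<comment> \<open>The result on simple poles expects the pole at the lattice, so \<open>p\<close>
    is translated to 0; removing singularities fills in the values at the lattice points and at the
    other zeros of \<open>D\<close>.\<close>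
  define G where "G = (\<lambda>s. remove_sings g (s + p))"
  have per_G: "G (s + w) = G s" if "w \<in> L" for s w
  proof -
    have "remove_sings g ((s + p) + w) = remove_sings g (s + p)"
      by (intro remove_sings_periodic g_perL[OF that])
    thus ?thesis by (simp add: G_def add_ac)
  qed
  have "G analytic_on {s}" if s: "s \<notin> L" for s
  proof -
    obtain b where "(g \<longlongrightarrow> b) (at (s + p))" using lim_q[of "s + p"] s by auto
    hence *: "remove_sings g analytic_on {s + p}" by (rule remove_sings_analytic_at[OF g_iso])
    have "(remove_sings g \<circ> (\<lambda>s. s + p)) analytic_on {s}"
      by (rule analytic_on_compose) (use * in \<open>auto intro: analytic_intros\<close>)
    thus ?thesis by (simp add: G_def o_def)
  qed
  hence "G analytic_on - L" by (subst analytic_on_analytic_at) simp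
  hence G_hol: "G holomorphic_on - L" by (rule analytic_imp_holomorphic)
  have G_lim: "((\<lambda>s. s * G s) \<longlongrightarrow> r) (at 0)"
  proof -
    have "eventually (\<lambda>s. (s - p) * g s = (s - p) * remove_sings g s) (at p)"
      using eventually_remove_sings_eq_at[OF g_iso[of p]] by eventually_elim simp
    with r have "((\<lambda>s. (s - p) * remove_sings g s) \<longlongrightarrow> r) (at p)"
      by (rule Lim_transform_eventually)
    thus ?thesis unfolding filterlim_at_to_0[of _ _ p] by (simp add: G_def)
  qed
  obtain K where K: "\<And>s. s \<notin> L \<Longrightarrow> G s = K"
    by (rule elliptic_simple_pole_constant[of G, OF per_G[OF generators_in_lattice(1)]
          per_G[OF generators_in_lattice(2)] G_hol G_lim]) blast
  have eq: "f s * theta s ^ Suc n = K * D s" if s: "s \<notin> L" "D s \<noteq> 0" for s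
  proof -
    have "s - p \<notin> L" using s(2) unfolding D_0 p_def by blast
    hence "remove_sings g s = K" using K[of "s - p"] by (simp add: G_def)
    moreover have "remove_sings g s = g s" by (rule remove_sings_at_analytic[OF g_ana[OF s]])
    ultimately have "g s = K" by simp
    moreover have "f s * theta s ^ Suc n = g s * D s" using s(2) by (simp add: g_def)
    ultimately show ?thesis by (simp only:)
  qed
  show ?thesis
  proof (rule that[of K])
    fix s assume s: "s \<notin> L"
    \<comment> \<open>The identity is known only where \<open>D\<close> is nonzero. Both sides are
      continuous off the lattice, so it extends to the zeros of \<open>D\<close>, in particular to
      \<open>z n\<close>.\<close>
    have "isCont f s" by (rule isCont_complement_lattice[OF hol s])
    hence "isCont (\<lambda>s. f s * theta s ^ Suc n - K * D s) s"
      by (intro continuous_intros isCont_theta D_cont)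
    hence "((\<lambda>s. f s * theta s ^ Suc n - K * D s) \<longlongrightarrow> f s * theta s ^ Suc n - K * D s) (at s)"
      by (simp only: isCont_def)
    moreover have "eventually (\<lambda>s. f s * theta s ^ Suc n - K * D s = 0) (at s)"
      using ev_good[of s] by eventually_elim (simp add: eq del: power_Suc)
    hence "((\<lambda>s. f s * theta s ^ Suc n - K * D s) \<longlongrightarrow> 0) (at s)"
      by (rule tendsto_eventually)
    ultimately have "f s * theta s ^ Suc n - K * D s = 0"
      using tendsto_unique[OF at_neq_bot] by blast
    thus "f s * theta s ^ Suc n = K * (\<Prod>i\<le>n. theta (s - z i))" by (simp add: D_def)
  qed
qed

section \<open>Points with equal values of the elliptic function\<close>

lemma wp_not_constant: "\<exists>s. s \<notin> L \<and> wp w1 w2 s \<noteq> c"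
proof (rule ccontr)
  assume "\<not> ?thesis"
  hence const: "wp w1 w2 s = c" if "s \<notin> L" for s using that by blast
  have "eventually (\<lambda>s. s ^ 2 * wp w1 w2 s = s ^ 2 * c) (at 0)"
    using eventually_not_in_lattice[of 0 0] by eventually_elim (simp add: const)
  with wp_tendsto have "((\<lambda>s. s ^ 2 * c) \<longlongrightarrow> 1) (at 0)" by (rule Lim_transform_eventually)
  moreover have "((\<lambda>s. s ^ 2 * c) \<longlongrightarrow> 0 ^ 2 * c) (at (0 :: complex))" by (intro tendsto_intros)
  ultimately have "1 = 0 ^ 2 * c" by (rule tendsto_unique[OF at_neq_bot])
  thus False by simp
qed

lemma wp_minus_const_tendsto: "((\<lambda>s. s ^ 2 * (wp w1 w2 s - c)) \<longlongrightarrow> 1) (at 0)"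
proof -
  have "((\<lambda>s. s ^ 2 * wp w1 w2 s - s ^ 2 * c) \<longlongrightarrow> 1 - 0 ^ 2 * c) (at 0)"
    by (intro tendsto_diff[OF wp_tendsto] tendsto_intros)
  thus ?thesis by (simp add: right_diff_distrib)
qed

text \<open>\<open>wp s - wp a\<close> has a double pole, so the factorization with
  \<open>n = 1\<close> applies to the zeros \<open>a\<close> and \<open>- a\<close>, which are
  incongruent as \<open>2 * a \<notin> L\<close>. A further zero \<open>b\<close> would make
  \<open>K\<close> vanish and \<open>wp\<close> constant.\<close>

lemma wp_eq_imp_aux:
  assumes "a \<notin> L" "b \<notin> L" "2 * a \<notin> L" "wp w1 w2 a = wp w1 w2 b"
  shows "a - b \<in> L \<or> a + b \<in> L"
proof (rule ccontr)
  assume neg: "\<not> ?thesis"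
  define f where "f = (\<lambda>s. wp w1 w2 s - wp w1 w2 a)"
  define z where "z = (\<lambda>i :: nat. if i = 0 then a else - a)"
  have per: "f (s + 2 * w1) = f s" "f (s + 2 * w2) = f s" for s
    by (simp_all add: f_def wp_periodic)
  have hol: "f holomorphic_on - L" unfolding f_def by (intro holomorphic_intros wp_holomorphic)
  have lim: "((\<lambda>s. s ^ Suc 1 * f s) \<longlongrightarrow> 1) (at 0)"
    using wp_minus_const_tendsto unfolding f_def by (simp add: power2_eq_square)
  obtain K where K: "\<And>s. s \<notin> L \<Longrightarrow> f s * theta s ^ Suc 1 = K * (\<Prod>i\<le>1. theta (s - z i))"
  proof (rule elliptic_theta_factorization[OF per hol lim])
    show "(\<Sum>i\<le>1. z i) = 0" by (simp add: z_def)
    fix i j :: nat assume "i \<le> 1" "j \<le> 1" "i \<noteq> j"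
    hence "i = 0 \<and> j = 1 \<or> i = 1 \<and> j = 0" by auto
    moreover have "- a - a \<notin> L" using assms(3) lattice_uminus_iff[of "2 * a"] by simp
    ultimately show "z i - z j \<notin> L" using assms(3) by (auto simp: z_def)
  next
    show "z i \<notin> L" for i using assms by (simp add: z_def)
    show "f (z i) = 0" if "i < 1" for i using that by (simp add: z_def f_def)
  qed blast
  have "(\<Prod>i\<le>1. theta (b - z i)) \<noteq> 0"
    using neg lattice_diff_commute[of a b] by (simp add: z_def theta_eq_0_iff add.commute)
  moreover have "K * (\<Prod>i\<le>1. theta (b - z i)) = 0"
    using K[OF assms(2)] assms(4) by (simp add: f_def)
  ultimately have "K = 0" by simp
  hence "f s = 0" if "s \<notin> L" for s
    using K[OF that] that by (simp add: theta_eq_0_iff)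
  thus False using wp_not_constant[of "wp w1 w2 a"] by (auto simp: f_def)
qed

text \<open>If \<open>2 * a\<close> or \<open>2 * b\<close> is not a period, symmetry reduces to the
  previous case. For two half periods the zeros \<open>a\<close> and \<open>- a\<close> merge;
  instead the double pole is regarded as a pole of order at most 3, with prescribed zeros
  \<open>a\<close>, \<open>b\<close> and last point \<open>- a - b\<close>. The missing pole order
  then forces \<open>K = 0\<close>.\<close>

lemma wp_eq_imp:
  assumes "a \<notin> L" "b \<notin> L" "wp w1 w2 a = wp w1 w2 b"
  shows "a - b \<in> L \<or> a + b \<in> L"
proof (cases "2 * a \<in> L \<and> 2 * b \<in> L")
  case False
  thus ?thesis
    using wp_eq_imp_aux[of a b] wp_eq_imp_aux[of b a] assms lattice_diff_commute[of a b]
    by (auto simp: add.commute)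
next
  case two: True
  show ?thesis
  proof (rule ccontr)
    assume neg: "\<not> ?thesis"
    define f where "f = (\<lambda>s. wp w1 w2 s - wp w1 w2 a)"
    define z where "z = (\<lambda>i :: nat. if i = 0 then a else if i = 1 then b else - a - b)"
    have per: "f (s + 2 * w1) = f s" "f (s + 2 * w2) = f s" for s
      by (simp_all add: f_def wp_periodic)
    have hol: "f holomorphic_on - L" unfolding f_def by (intro holomorphic_intros wp_holomorphic)
    have lim2: "((\<lambda>s. s ^ 2 * f s) \<longlongrightarrow> 1) (at 0)"
      using wp_minus_const_tendsto unfolding f_def .
    \<comment> \<open>One power of \<open>s\<close> more than the pole requires, so the limit is 0;
      this fits the factorization with \<open>n = 2\<close>.\<close>
    have lim: "((\<lambda>s. s ^ Suc 2 * f s) \<longlongrightarrow> 0 * 1) (at 0)"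
      using tendsto_mult[OF tendsto_ident_at lim2] by (simp only: power_Suc mult.assoc)
    have c: "- a - b \<notin> L"
      using neg lattice_uminus_iff[of "a + b"] by simp
    have ac: "a - (- a - b) \<notin> L"
    proof -
      have "a - (- a - b) = b + 2 * a" by simp
      thus ?thesis using two assms by (simp only: lattice_add_right_iff simp_thms)
    qed
    have bc: "b - (- a - b) \<notin> L"
    proof -
      have "b - (- a - b) = a + 2 * b" by simp
      thus ?thesis using two assms by (simp only: lattice_add_right_iff simp_thms)
    qed
    obtain K where K: "\<And>s. s \<notin> L \<Longrightarrow> f s * theta s ^ Suc 2 = K * (\<Prod>i\<le>2. theta (s - z i))"
    proof (rule elliptic_theta_factorization[OF per hol lim])
      show "(\<Sum>i\<le>2. z i) = 0" by (simp add: z_def numeral_2_eq_2)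
      fix i j :: nat assume "i \<le> 2" "j \<le> 2" "i \<noteq> j"
      hence "(i = 0 \<or> i = 1 \<or> i = 2) \<and> (j = 0 \<or> j = 1 \<or> j = 2)" by auto
      moreover have "z 0 = a" "z 1 = b" "z 2 = - a - b" by (simp_all add: z_def)
      moreover have "a - b \<notin> L" "b - a \<notin> L" using neg lattice_diff_commute[of a b] by blast+
      moreover have "(- a - b) - a \<notin> L" "(- a - b) - b \<notin> L"
        using ac bc lattice_diff_commute by blast+
      ultimately show "z i - z j \<notin> L" using ac bc \<open>i \<noteq> j\<close> by metis
    next
      show "z i \<notin> L" for i using assms c by (simp add: z_def)
      show "f (z i) = 0" if "i < 2" for i using that assms by (auto simp: z_def f_def)
    qed blast
    define D where "D = (\<lambda>s. \<Prod>i\<le>2. theta (s - z i))"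
    have D0: "D 0 \<noteq> 0"
      unfolding D_def using assms c by (subst prod_theta_eq_0_iff) (simp_all add: z_def)
    obtain ct where ct: "((\<lambda>s. theta s / s) \<longlongrightarrow> ct) (at 0)" using theta_simple_zero by blast
    have "(theta \<longlongrightarrow> theta 0) (at 0)" using isCont_theta by (simp add: isCont_def)
    hence th: "(theta \<longlongrightarrow> 0) (at 0)" using theta_eq_0_iff[of 0] by simp
    \<comment> \<open>Two of the three theta factors cancel the double pole and the third tends to
      0. The other side tends to \<open>K * D 0\<close> with \<open>D 0\<close> nonzero.\<close>
    have "((\<lambda>s. (s ^ 2 * f s) * (theta s / s) ^ 2 * theta s) \<longlongrightarrow> 1 * ct ^ 2 * 0) (at 0)"
      by (intro tendsto_mult tendsto_power lim2 ct th)
    moreover have "eventually (\<lambda>s. (s ^ 2 * f s) * (theta s / s) ^ 2 * theta s = K * D s) (at 0)"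
    proof -
      have "eventually (\<lambda>s. s - 0 \<notin> L) (at (0::complex))" by (rule eventually_not_in_lattice)
      moreover have "eventually (\<lambda>s. s \<noteq> 0) (at (0::complex))" by (simp add: eventually_at_filter)
      ultimately show ?thesis
      proof eventually_elim
        case (elim s)
        have "(s ^ 2 * f s) * (theta s / s) ^ 2 * theta s = f s * theta s ^ Suc 2"
          using elim(2) by (simp add: power_divide power2_eq_square power3_eq_cube)
        also have "\<dots> = K * D s" unfolding D_def by (rule K) (use elim(1) in simp)
        finally show ?case .
      qed
    qed
    ultimately have "((\<lambda>s. K * D s) \<longlongrightarrow> 1 * ct ^ 2 * 0) (at 0)"
      by (rule Lim_transform_eventually)
    moreover have "((\<lambda>s. K * D s) \<longlongrightarrow> K * D 0) (at 0)"
      using isCont_prod_theta[where A = "{..2}" and z = z and s = 0]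
      unfolding D_def isCont_def by (intro tendsto_mult tendsto_const)
    ultimately have "1 * ct ^ 2 * 0 = K * D 0" by (rule tendsto_unique[OF at_neq_bot])
    hence "K = 0" using D0 by simp
    hence "f s = 0" if "s \<notin> L" for s
      using K[OF that] that by (simp add: theta_eq_0_iff)
    thus False using wp_not_constant[of "wp w1 w2 a"] by (auto simp: f_def)
  qed
qed

end

section \<open>Vieta's formulas\<close>

text \<open>The set \<open>B\<close> collects the factors that contribute their constant term.
  Indexing by subsets matches the definition of \<open>esym\<close>.\<close>

lemma prod_linear_factors_expand:
  fixes x :: "nat \<Rightarrow> complex"
  shows "(\<Prod>i<N. [:- x i, 1:]) = (\<Sum>B\<in>Pow {..<N}. monom (\<Prod>i\<in>B. - x i) (N - card B))"
proof -
  have const: "(\<Prod>i\<in>B. [:- x i:]) = [:\<Prod>i\<in>B. - x i:]" if "finite B" for B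
    using that by (induction B rule: finite_induct) auto
  have "(\<Prod>i<N. [:- x i, 1:]) = (\<Prod>i<N. [:- x i:] + [:0, 1:])"
    by simp
  also have "\<dots> = (\<Sum>B\<in>Pow {..<N}. (\<Prod>i\<in>B. [:- x i:]) * (\<Prod>i\<in>{..<N} - B. [:0, 1:]))"
    by (rule prod_add) simp
  also have "\<dots> = (\<Sum>B\<in>Pow {..<N}. monom (\<Prod>i\<in>B. - x i) (N - card B))"
  proof (rule sum.cong[OF refl])
    fix B assume B: "B \<in> Pow {..<N}"
    hence fin: "finite B" by (auto intro: finite_subset)
    have "card ({..<N} - B) = N - card B" using B fin by (subst card_Diff_subset) auto
    hence "(\<Prod>i\<in>{..<N} - B. [:0, 1 :: complex:]) = [:0, 1:] ^ (N - card B)" by simp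
    thus "(\<Prod>i\<in>B. [:- x i:]) * (\<Prod>i\<in>{..<N} - B. [:0, 1:]) = monom (\<Prod>i\<in>B. - x i) (N - card B)"
      by (simp only: const[OF fin] monom_altdef) simp
  qed
  finally show ?thesis .
qed

lemma coeff_prod_linear_factors:
  assumes "r \<le> length xs"
  shows "coeff (\<Prod>i<length xs. [:- xs ! i, 1:]) (length xs - r) = (- 1) ^ r * esym r xs"
proof -
  define N where "N = length xs"
  have "coeff (\<Prod>i<N. [:- xs ! i, 1:]) (N - r)
      = (\<Sum>B\<in>Pow {..<N}. if N - card B = N - r then \<Prod>i\<in>B. - xs ! i else 0)"
    by (simp add: prod_linear_factors_expand coeff_sum)
  also have "\<dots> = (\<Sum>B\<in>{B \<in> Pow {..<N}. N - card B = N - r}. \<Prod>i\<in>B. - xs ! i)"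
    by (simp add: sum.If_cases Int_def conj_commute)
  also have "{B \<in> Pow {..<N}. N - card B = N - r} = {B. B \<subseteq> {0..<N} \<and> card B = r}"
  proof -
    have "N - card B = N - r \<longleftrightarrow> card B = r" if "B \<subseteq> {..<N}" for B
    proof -
      have "card B \<le> N" using card_mono[OF _ that] by simp
      moreover have "r \<le> N" using assms by (simp add: N_def)
      ultimately show ?thesis by linarith
    qed
    thus ?thesis by (auto simp: lessThan_atLeast0)
  qed
  also have "(\<Sum>B\<in>{B. B \<subseteq> {0..<N} \<and> card B = r}. \<Prod>i\<in>B. - xs ! i) = (- 1) ^ r * esym r xs"
    unfolding esym_def N_def sum_distrib_left
  proof (rule sum.cong[OF refl])
    fix B assume B: "B \<in> {B. B \<subseteq> {0..<length xs} \<and> card B = r}"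
    have "(\<Prod>i\<in>B. - xs ! i) = (\<Prod>i\<in>B. (- 1) * xs ! i)" by simp
    also have "\<dots> = (- 1) ^ r * (\<Prod>i\<in>B. xs ! i)"
      using B by (simp only: prod.distrib prod_constant) simp
    finally show "(\<Prod>i\<in>B. - xs ! i) = (- 1) ^ r * (\<Prod>i\<in>B. xs ! i)" .
  qed
  finally show ?thesis by (simp add: N_def)
qed

text \<open>A nonzero polynomial of degree at most \<open>N\<close> with \<open>N\<close> distinct
  roots has degree exactly \<open>N\<close> and no other roots. The value at \<open>y\<close> serves
  to exclude the zero polynomial.\<close>

lemma vieta_distinct_roots:
  assumes dist: "distinct xs" and N: "length xs = N"
    and roots: "\<And>x. x \<in> set xs \<Longrightarrow> (\<Sum>r\<le>N. \<mu> r * x ^ r) = 0"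
    and nonzero: "(\<Sum>r\<le>N. \<mu> r * y ^ r) \<noteq> 0"
  shows "\<mu> N \<noteq> 0" "{x. (\<Sum>r\<le>N. \<mu> r * x ^ r) = 0} = set xs"
    "\<And>r. r \<le> N \<Longrightarrow> esym r xs = (- 1) ^ r * \<mu> (N - r) / \<mu> N"
proof -
  define p where "p = (\<Sum>r\<le>N. monom (\<mu> r) r)"
  have poly_p: "poly p x = (\<Sum>r\<le>N. \<mu> r * x ^ r)" for x
    by (simp add: p_def poly_sum poly_monom)
  have coeff_p: "coeff p r = (if r \<le> N then \<mu> r else 0)" for r
    by (simp add: p_def coeff_sum)
  have deg_le: "degree p \<le> N" by (rule degree_le) (simp add: coeff_p)
  have "p \<noteq> 0" using nonzero poly_p[of y] by auto
  have sub: "set xs \<subseteq> {x. poly p x = 0}" using roots by (auto simp: poly_p)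
  have fin: "finite {x. poly p x = 0}" using \<open>p \<noteq> 0\<close> by (rule poly_roots_finite)
  have card_xs: "card (set xs) = N" using dist N by (simp add: distinct_card)
  have "card (set xs) \<le> card {x. poly p x = 0}" by (rule card_mono[OF fin sub])
  moreover have "card {x. poly p x = 0} \<le> degree p" using \<open>p \<noteq> 0\<close> by (rule card_poly_roots_bound)
  ultimately have deg: "degree p = N" and "card (set xs) = card {x. poly p x = 0}"
    using card_xs deg_le by auto
  hence set_eq: "set xs = {x. poly p x = 0}" by (intro card_subset_eq fin sub)
  have "\<mu> N = lead_coeff p" by (simp add: deg coeff_p)
  thus muN: "\<mu> N \<noteq> 0" using \<open>p \<noteq> 0\<close> by simp
  show "{x. (\<Sum>r\<le>N. \<mu> r * x ^ r) = 0} = set xs" using set_eq by (simp add: poly_p)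
  define q where "q = (\<Prod>i<length xs. [:- xs ! i, 1:])"
  have coeff_q: "coeff q (N - r) = (- 1) ^ r * esym r xs" if "r \<le> N" for r
    using coeff_prod_linear_factors[of r xs] that N by (simp add: q_def)
  have "coeff q N = 1"
  proof -
    have "{I. I \<subseteq> {0..<length xs} \<and> card I = 0} = {{}}"
      by (auto dest: finite_subset)
    thus ?thesis using coeff_q[of 0] by (simp add: esym_def)
  qed
  have deg_q: "degree q \<le> N"
  proof -
    have "degree q \<le> (\<Sum>i<length xs. degree [:- xs ! i, 1:])"
      unfolding q_def by (rule order.trans[OF degree_prod_sum_le]) auto
    thus ?thesis using N by simp
  qed
  have "p = Polynomial.smult (\<mu> N) q"
  proof (rule ccontr)
    assume ne: "p \<noteq> Polynomial.smult (\<mu> N) q"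
    define d where "d = p - Polynomial.smult (\<mu> N) q"
    have "d \<noteq> 0" using ne by (simp add: d_def)
    have "poly d x = 0" if "x \<in> set xs" for x
    proof -
      obtain i where "i < length xs" "xs ! i = x" using \<open>x \<in> set xs\<close> by (auto simp: in_set_conv_nth)
      hence "poly q x = 0" unfolding q_def poly_prod by (intro prod_zero) auto
      moreover have "poly p x = 0" using sub that by blast
      ultimately show ?thesis by (simp add: d_def)
    qed
    hence "card (set xs) \<le> card {x. poly d x = 0}"
      by (intro card_mono poly_roots_finite[OF \<open>d \<noteq> 0\<close>]) auto
    also have "\<dots> \<le> degree d" using \<open>d \<noteq> 0\<close> by (rule card_poly_roots_bound)
    finally have "N \<le> degree d" using card_xs by simp
    \<comment> \<open>The leading terms of \<open>p\<close> and \<open>\<mu> N * q\<close> agree, so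
      \<open>d\<close> has coefficient 0 at \<open>N\<close>; a degree of exactly \<open>N\<close>,
      which the \<open>N\<close> roots would force, is impossible.\<close>
    moreover have "degree d \<le> N"
      unfolding d_def by (intro degree_diff_le deg_le order.trans[OF degree_smult_le deg_q])
    ultimately have "lead_coeff d = coeff d N" by simp
    also have "\<dots> = 0" by (simp add: d_def coeff_p \<open>coeff q N = 1\<close>)
    finally show False using \<open>d \<noteq> 0\<close> by simp
  qed
  hence coeff_eq: "coeff p r = \<mu> N * coeff q r" for r by simp
  show "esym r xs = (- 1) ^ r * \<mu> (N - r) / \<mu> N" if "r \<le> N" for r
  proof -
    have "\<mu> (N - r) = \<mu> N * ((- 1) ^ r * esym r xs)"
      using coeff_eq[of "N - r"] by (simp add: coeff_p coeff_q[OF that])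
    hence "(- 1) ^ r * \<mu> (N - r) = \<mu> N * (((- 1) ^ r * (- 1) ^ r) * esym r xs)" by (simp only: mult_ac)
    also have "(- 1) ^ r * (- 1) ^ r = (1 :: complex)" by (simp flip: power_mult_distrib)
    finally show ?thesis using muN by simp
  qed
qed

section \<open>The polynomial and its roots\<close>

text \<open>Abel's theorem in the form used here. The last two assumptions say that minus the sum of
  the given zeros is off the lattice and incongruent to each of them, as the factorization
  requires.\<close>

lemma (in half_periods) elliptic_last_zero:
  assumes "\<And>s. f (s + 2 * w1) = f s" "\<And>s. f (s + 2 * w2) = f s"
    and "f holomorphic_on - L"
    and "((\<lambda>s. s ^ Suc n * f s) \<longlongrightarrow> c) (at 0)"
    and "\<And>i j. i < n \<Longrightarrow> j < n \<Longrightarrow> i \<noteq> j \<Longrightarrow> z i - z j \<notin> L"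
    and "\<And>i. i < n \<Longrightarrow> z i \<notin> L" "\<And>i. i < n \<Longrightarrow> f (z i) = 0"
    and "(\<Sum>i<n. z i) \<notin> L" "\<And>i. i < n \<Longrightarrow> (\<Sum>i<n. z i) + z i \<notin> L"
  shows "f (- (\<Sum>i<n. z i)) = 0"
proof -
  define p where "p = - (\<Sum>i<n. z i)"
  define Z where "Z = (\<lambda>i. if i < n then z i else p)"
  have p: "p \<notin> L" "\<And>i. i < n \<Longrightarrow> z i - p \<notin> L"
    using assms(8,9) by (simp_all add: p_def add.commute)
  have p': "p - z i \<notin> L" if "i < n" for i using p(2)[OF that] lattice_diff_commute[of p "z i"] by blast
  obtain K where K: "\<And>s. s \<notin> L \<Longrightarrow> f s * theta s ^ Suc n = K * (\<Prod>i\<le>n. theta (s - Z i))"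
  proof (rule elliptic_theta_factorization[OF assms(1-4)])
    have "(\<Sum>i<n. Z i) = (\<Sum>i<n. z i)" by (rule sum.cong) (auto simp: Z_def)
    thus "(\<Sum>i\<le>n. Z i) = 0" by (simp add: Z_def p_def flip: lessThan_Suc_atMost)
    fix i j assume "i \<le> n" "j \<le> n" "i \<noteq> j"
    thus "Z i - Z j \<notin> L" using assms(5)[of i j] p(2)[of i] p'[of j]
      unfolding Z_def by (cases "i < n"; cases "j < n") simp_all
  next
    show "Z i \<notin> L" for i using assms(6) p(1) by (simp add: Z_def)
    show "f (Z i) = 0" if "i < n" for i using assms(7) that by (simp add: Z_def)
  qed blast
  \<comment> \<open>The factor of index \<open>n\<close> is \<open>theta 0\<close>. On the other
    side of the factorization \<open>theta p\<close> is nonzero, so \<open>f p\<close> has to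
    vanish.\<close>
  have "(\<Prod>i\<le>n. theta (p - Z i)) = 0"
    by (subst prod_theta_eq_0_iff) (auto simp: Z_def intro!: bexI[of _ n])
  hence "f p * theta p ^ Suc n = 0" using K[OF p(1)] by simp
  thus ?thesis using p(1) by (simp add: theta_eq_0_iff p_def)
qed

theorem mainTheorem4:
  fixes w1 w2 :: complex
    and m l :: nat
    and n k :: "nat \<Rightarrow> int"
    and gam lam zs \<mu> :: "nat \<Rightarrow> complex"
    and z :: complex
  defines "\<Lambda> \<equiv> lattice w1 w2"
  defines "P \<equiv> wpd w1 w2"
  defines "\<phi> \<equiv> (\<lambda>s.
      ((\<Sum>i | i < m \<and> odd (n i). gam i * P (n i) s) - (\<Sum>i | i < l \<and> odd (k i). lam i * P (k i) s))^2
    - ((\<Sum>i | i < m \<and> even (n i). gam i * P (n i) s) - (\<Sum>i | i < l \<and> even (k i). lam i * P (k i) s))^2)"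
  assumes "Im (w2 / w1) > 0"
    and "m \<ge> 1" and "l \<ge> 1"
    and "\<forall>i<m. n i \<ge> -2 \<and> n i \<noteq> -1" and "inj_on n {..<m}"
    and "\<forall>i<l. k i \<ge> -2 \<and> k i \<noteq> -1" and "inj_on k {..<l}"
    and "int l = max (Max (n ` {..<m})) (Max (k ` {..<l})) + 1"
    and "\<forall>i<l. zs i \<notin> \<Lambda>"
    and "det (mat l l (\<lambda>(i, j). P (k j) (zs i))) \<noteq> 0"
    and "\<forall>j<l. (\<Sum>i<m. gam i * P (n i) (zs j)) = (\<Sum>i<l. lam i * P (k i) (zs j))"
    and "z = (\<Sum>i<l. zs i)" and "z \<notin> \<Lambda>"
    and "(\<Sum>i | i < m \<and> n i = int l - 1. gam i) - (\<Sum>i | i < l \<and> k i = int l - 1. lam i) \<noteq> 0"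
    and "\<forall>s. s \<notin> \<Lambda> \<longrightarrow> \<phi> s = (\<Sum>r\<le>l+1. \<mu> r * (wp w1 w2 s)^r)"
    and "\<exists>s. s \<notin> \<Lambda> \<and> \<phi> s \<noteq> 0"
    and "\<forall>i<l. z - zs i \<notin> \<Lambda> \<and> z + zs i \<notin> \<Lambda>"
    and "\<forall>i<l. \<forall>j<l. i \<noteq> j \<longrightarrow> zs i + zs j \<notin> \<Lambda>"
  shows "\<mu> (l+1) \<noteq> 0
    \<and> distinct (map (\<lambda>i. wp w1 w2 (zs i)) [0..<l] @ [wp w1 w2 z])
    \<and> {x. (\<Sum>r\<le>l+1. \<mu> r * x^r) = 0} = set (map (\<lambda>i. wp w1 w2 (zs i)) [0..<l] @ [wp w1 w2 z])
    \<and> (\<forall>r\<le>l+1. esym r (map (\<lambda>i. wp w1 w2 (zs i)) [0..<l] @ [wp w1 w2 z])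
                 = (-1)^r * \<mu> (l + 1 - r) / \<mu> (l + 1))"
proof -
  note Lam = assms(1) and Pdef = assms(2) and phi = assms(3)
  note im = assms(4) and n_range = assms(7) and k_range = assms(9) and l_eq = assms(11)
    and zs_notin = assms(12) and det_nz = assms(13) and interp = assms(14) and z_eq = assms(15)
    and z_notin = assms(16) and phi_poly = assms(18) and phi_nz = assms(19) and z_zs = assms(20)
    and zs_zs = assms(21)
  interpret half_periods w1 w2 by unfold_locales (rule im)
  \<comment> \<open>As \<open>l\<close> exceeds the largest index by 1, every \<open>P (n i)\<close>
    has pole order at most \<open>l + 1\<close>, which is the exponent in the limit for \<psi>
    below.\<close>
  have n_idx: "n i = -2 \<or> n i \<ge> 0" "n i + 2 \<le> int (l + 1)" if "i < m" for i
  proof -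
    have "n i \<ge> -2" "n i \<noteq> -1" using n_range that by auto
    thus "n i = -2 \<or> n i \<ge> 0" by linarith
    have "n i \<le> Max (n ` {..<m})" using that by (intro Max_ge) auto
    thus "n i + 2 \<le> int (l + 1)" using l_eq by linarith
  qed
  have k_idx: "k i = -2 \<or> k i \<ge> 0" "k i + 2 \<le> int (l + 1)" if "i < l" for i
  proof -
    have "k i \<ge> -2" "k i \<noteq> -1" using k_range that by auto
    thus "k i = -2 \<or> k i \<ge> 0" by linarith
    have "k i \<le> Max (k ` {..<l})" using that by (intro Max_ge) auto
    thus "k i + 2 \<le> int (l + 1)" using l_eq by linarith
  qed

  define A where "A = (\<lambda>s. (\<Sum>i | i < m \<and> odd (n i). gam i * P (n i) s) - (\<Sum>i | i < l \<and> odd (k i). lam i * P (k i) s))"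
  define B where "B = (\<lambda>s. (\<Sum>i | i < m \<and> even (n i). gam i * P (n i) s) - (\<Sum>i | i < l \<and> even (k i). lam i * P (k i) s))"
  define \<psi> where "\<psi> = (\<lambda>s. (\<Sum>i<m. gam i * P (n i) s) - (\<Sum>i<l. lam i * P (k i) s))"
  have split: "(\<Sum>i | i < N \<and> odd (q i). g i) + (\<Sum>i | i < N \<and> even (q i). g i) = (\<Sum>i<N. g i)"
    for N and q :: "nat \<Rightarrow> int" and g :: "nat \<Rightarrow> complex"
  proof -
    have "{..<N} = {i. i < N \<and> odd (q i)} \<union> {i. i < N \<and> even (q i)}" by auto
    thus ?thesis by (subst sum.union_disjoint[symmetric]) auto
  qed
  have psi_AB: "\<psi> s = A s + B s" for s
    unfolding \<psi>_def A_def B_def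
      split[where N = m and q = n and g = "\<lambda>i. gam i * P (n i) s", symmetric]
      split[where N = l and q = k and g = "\<lambda>i. lam i * P (k i) s", symmetric]
    by (rule add_diff_add)
  have psi_minus: "\<psi> (- s) = B s - A s" if s: "s \<notin> L" for s
  proof -
    have "A (- s) = - A s"
    proof -
      have "(\<Sum>i | i < m \<and> odd (n i). gam i * P (n i) (- s)) = (\<Sum>i | i < m \<and> odd (n i). - (gam i * P (n i) s))"
        by (rule sum.cong[OF refl]) (use s n_idx in \<open>simp add: Pdef wpd_minus\<close>)
      moreover have "(\<Sum>i | i < l \<and> odd (k i). lam i * P (k i) (- s)) = (\<Sum>i | i < l \<and> odd (k i). - (lam i * P (k i) s))"
        by (rule sum.cong[OF refl]) (use s k_idx in \<open>simp add: Pdef wpd_minus\<close>)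
      ultimately show ?thesis by (simp add: A_def sum_negf)
    qed
    moreover have "B (- s) = B s"
    proof -
      have "(\<Sum>i | i < m \<and> even (n i). gam i * P (n i) (- s)) = (\<Sum>i | i < m \<and> even (n i). gam i * P (n i) s)"
        by (rule sum.cong[OF refl]) (use s n_idx in \<open>simp add: Pdef wpd_minus\<close>)
      moreover have "(\<Sum>i | i < l \<and> even (k i). lam i * P (k i) (- s)) = (\<Sum>i | i < l \<and> even (k i). lam i * P (k i) s)"
        by (rule sum.cong[OF refl]) (use s k_idx in \<open>simp add: Pdef wpd_minus\<close>)
      ultimately show ?thesis by (simp add: B_def)
    qed
    ultimately show ?thesis by (simp add: psi_AB)
  qed
  have phi_psi: "\<phi> s = - (\<psi> s * \<psi> (- s))" if "s \<notin> L" for s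
  proof -
    have "\<phi> s = (A s)\<^sup>2 - (B s)\<^sup>2" by (simp only: phi A_def B_def)
    thus ?thesis unfolding psi_AB[of s] psi_minus[OF that] by (simp add: power2_eq_square algebra_simps)
  qed

  have psi_per: "\<psi> (s + w) = \<psi> s" if "w \<in> L" for s w
    unfolding \<psi>_def Pdef wpd_periodic[OF that] ..
  have psi_hol: "\<psi> holomorphic_on - L"
    unfolding \<psi>_def Pdef
    by (intro holomorphic_on_diff holomorphic_on_sum holomorphic_on_mult holomorphic_on_const wpd_holomorphic)
  have "\<exists>c. ((\<lambda>s. s ^ (l + 1) * \<psi> s) \<longlongrightarrow> c) (at 0)"
  proof -
    have "\<forall>i\<in>{..<m}. \<exists>c. ((\<lambda>s. s ^ (l + 1) * P (n i) s) \<longlongrightarrow> c) (at 0)"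
      unfolding Pdef using n_idx by (intro ballI wpd_tendsto) auto
    then obtain a where a: "\<And>i. i < m \<Longrightarrow> ((\<lambda>s. s ^ (l + 1) * P (n i) s) \<longlongrightarrow> a i) (at 0)"
      using bchoice[of "{..<m}"] by (metis lessThan_iff)
    have "\<forall>i\<in>{..<l}. \<exists>c. ((\<lambda>s. s ^ (l + 1) * P (k i) s) \<longlongrightarrow> c) (at 0)"
      unfolding Pdef using k_idx by (intro ballI wpd_tendsto) auto
    then obtain b where b: "\<And>i. i < l \<Longrightarrow> ((\<lambda>s. s ^ (l + 1) * P (k i) s) \<longlongrightarrow> b i) (at 0)"
      using bchoice[of "{..<l}"] by (metis lessThan_iff)
    have "((\<lambda>s. (\<Sum>i<m. gam i * (s ^ (l + 1) * P (n i) s)) - (\<Sum>i<l. lam i * (s ^ (l + 1) * P (k i) s)))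
        \<longlongrightarrow> (\<Sum>i<m. gam i * a i) - (\<Sum>i<l. lam i * b i)) (at 0)"
      by (intro tendsto_diff tendsto_sum tendsto_mult tendsto_const a b) simp_all
    moreover have "(\<lambda>s. (\<Sum>i<m. gam i * (s ^ (l + 1) * P (n i) s)) - (\<Sum>i<l. lam i * (s ^ (l + 1) * P (k i) s)))
        = (\<lambda>s. s ^ (l + 1) * \<psi> s)"
      unfolding \<psi>_def right_diff_distrib sum_distrib_left by (simp only: mult.left_commute)
    ultimately show ?thesis by (simp only:) blast
  qed
  then obtain c where c: "((\<lambda>s. s ^ Suc l * \<psi> s) \<longlongrightarrow> c) (at 0)" by auto

  \<comment> \<open>Congruent points would give two equal rows in the interpolation matrix,
    contradicting the nonvanishing determinant.\<close>
  have zs_diff: "zs i - zs j \<notin> L" if ij: "i < l" "j < l" "i \<noteq> j" for i j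
  proof
    assume "zs i - zs j \<in> L"
    from wpd_periodic[OF this, of _ "zs j"] have eq: "P q (zs i) = P q (zs j)" for q
      by (simp add: Pdef)
    let ?M = "mat l l (\<lambda>(i, j). P (k j) (zs i))"
    have "row ?M i = row ?M j" by (rule eq_vecI) (use ij eq in auto)
    moreover have "?M \<in> carrier_mat l l" by simp
    ultimately have "det ?M = 0" using ij det_identical_rows by blast
    thus False using det_nz by contradiction
  qed
  have psi_zs: "\<psi> (zs i) = 0" if "i < l" for i
    using interp that by (simp add: \<psi>_def)
  have "\<psi> (- (\<Sum>i<l. zs i)) = 0"
    by (rule elliptic_last_zero[OF psi_per[OF generators_in_lattice(1)] psi_per[OF generators_in_lattice(2)]
          psi_hol c zs_diff])
       (use zs_notin psi_zs z_notin z_zs in \<open>auto simp: Lam z_eq\<close>)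
  hence psi_z: "\<psi> (- z) = 0" by (simp only: z_eq)

  define xs where "xs = map (\<lambda>i. wp w1 w2 (zs i)) [0..<l] @ [wp w1 w2 z]"
  \<comment> \<open>Either factor of \<phi> may vanish: the first alternative serves the
    \<open>zs i\<close>, the second serves \<open>z\<close>, for which the known zero of \<psi> is
    \<open>- z\<close>.\<close>
  have poly_zero: "(\<Sum>r\<le>l+1. \<mu> r * (wp w1 w2 s)^r) = 0" if "s \<notin> L" "\<psi> s = 0 \<or> \<psi> (- s) = 0" for s
    using phi_poly phi_psi[OF that(1)] that by (auto simp: Lam)
  have zsL: "zs i \<notin> L" if "i < l" for i using zs_notin that by (simp add: Lam)
  have zL: "z \<notin> L" using z_notin by (simp add: Lam)
  have dist: "distinct xs"
  proof -
    \<comment> \<open>Equal values would make the points congruent up to sign; the determinant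
      excludes the difference and the hypothesis on \<open>zs i + zs j\<close> the sum.\<close>
    have "wp w1 w2 (zs i) \<noteq> wp w1 w2 (zs j)" if "i < l" "j < l" "i \<noteq> j" for i j
      using wp_eq_imp[OF zsL[OF that(1)] zsL[OF that(2)]] zs_diff[OF that] zs_zs that
      by (auto simp: Lam)
    hence "inj_on (\<lambda>i. wp w1 w2 (zs i)) {0..<l}" by (force simp: inj_on_def)
    moreover have "wp w1 w2 z \<notin> (\<lambda>i. wp w1 w2 (zs i)) ` {0..<l}"
    proof
      assume "wp w1 w2 z \<in> (\<lambda>i. wp w1 w2 (zs i)) ` {0..<l}"
      then obtain i where i: "i < l" "wp w1 w2 z = wp w1 w2 (zs i)" by auto
      thus False using wp_eq_imp[OF zL zsL[OF i(1)] i(2)] z_zs by (simp add: Lam)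
    qed
    ultimately show ?thesis by (simp add: xs_def distinct_map)
  qed
  have len: "length xs = l + 1" by (simp add: xs_def)
  have roots: "(\<Sum>r\<le>l+1. \<mu> r * x ^ r) = 0" if "x \<in> set xs" for x
  proof -
    from that consider i where "i < l" "x = wp w1 w2 (zs i)" | "x = wp w1 w2 z"
      by (auto simp: xs_def)
    thus ?thesis
    proof cases
      case 1
      show ?thesis unfolding 1(2) using zsL[OF 1(1)] psi_zs[OF 1(1)] by (intro poly_zero) auto
    next
      case 2
      show ?thesis unfolding 2 using zL psi_z by (intro poly_zero) auto
    qed
  qed
  \<comment> \<open>At a point where \<phi> does not vanish, \<open>wp s\<close> is the argument
    witnessing that the polynomial is not zero.\<close>
  obtain s where "s \<notin> L" "\<phi> s \<noteq> 0" using phi_nz by (auto simp: Lam)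
  hence "(\<Sum>r\<le>l+1. \<mu> r * (wp w1 w2 s) ^ r) \<noteq> 0" using phi_poly by (simp add: Lam)
  from vieta_distinct_roots[OF dist len roots this] dist
  show ?thesis unfolding xs_def by blast
qed

end
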